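(* If $\varphi$ is a free holomorphic automorphism of the noncommutative ball $[B(\mathcal H)^n]_1$, then $C_\varphi f\in H^2_{\bf ball}$ for all $f\in H^2_{\bf ball}$, and $$\left(\frac{1-\|\varphi(0)\|}{1+\|\varphi(0)\|}\right)^{1/2}\|f\|_2\le\|C_\varphi f\|_2\le\left(\frac{1+\|\varphi(0)\|}{1-\|\varphi(0)\|}\right)^{1/2}\|f\|_2$$ for all $f\in H^2_{\bf ball}$. Moreover, these inequalities are best possible (neither of the two constants can be improved), and $$\|C_\varphi\|=\left(\frac{1+\|\varphi(0)\|}{1-\|\varphi(0)\|}\right)^{1/2}.$$
   Context: $n\ge1$; $\mathcal H$ is a separable infinite dimensional complex Hilbert space. $\mathbb F_n^+$ is the free semigroup with generators $g_1,\ldots,g_n$ and identity $g_0$; $|g_0|=0$, $|\alpha|=k$ if $\alpha=g_{i_1}\cdots g_{i_k}$; $X_\alpha:=X_{i_1}\cdots X_{i_k}$, $X_{g_0}:=I$. $[B(\mathcal H)^n]_1:=\{(X_1,\ldots,X_n)\in B(\mathcal H)^n:\ \|X_1X_1^*+\cdots+X_nX_n^*\|^{1/2}<1\}$. A free holomorphic function $f:[B(\mathcal H)^n]_1\to B(\mathcal H)$ is a map $f(X)=\sum_{k=0}^\infty\sum_{|\alpha|=k}a_\alpha X_\alpha$ (series over $k$ converging in operator norm) with $a_\alpha\in\mathbb C$ and $\limsup_{k\to\infty}(\sum_{|\alpha|=k}|a_\alpha|^2)^{1/2k}\le1$. A free holomorphic self-map $\varphi=(\varphi_1,\ldots,\varphi_n)$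 of $[B(\mathcal H)^n]_1$ has each $\varphi_i$ free holomorphic and maps $[B(\mathcal H)^n]_1$ into itself; it is a free holomorphic automorphism if it is one-to-one, onto, and its inverse is also free holomorphic. $\varphi(0)$ is identified with a point of the open Euclidean unit ball $\mathbb B_n$ of $\mathbb C^n$, and $\|\varphi(0)\|$ is its Euclidean norm. With $\varphi_\alpha:=\varphi_{i_1}\cdots\varphi_{i_k}$, the composition is the free holomorphic function $(f\circ\varphi)(X)=\sum_{k=0}^\infty\sum_{|\alpha|=k}a_\alpha\varphi_\alpha(X)$ (convergence in operator norm), and $C_\varphi f:=f\circ\varphi$. $H^2_{\bf ball}$ is the Hilbert space of free holomorphic functions $f=\sum_\alpha a_\alpha X_\alpha$ on $[B(\mathcal H)^n]_1$ with $\|f\|_2^2:=\sum_{\alpha\in\mathbb F_n^+}|a_\alpha|^2<\infty$; $\|C_\varphi\|$ is the operator norm of $C_\varphi$ on $H^2_{\bf ball}$. *)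

theory Defs
  imports "HOL-Analysis.Analysis"
begin

(* Complex Hilbert spaces. The inner product is linear in the first argument;
   banach supplies the compatible real normed structure and completeness. *)
class complex_hilbert = banach +
  fixes scaleC :: "complex \<Rightarrow> 'a \<Rightarrow> 'a"  (infixr "*\<^sub>C" 75)
    and cinner :: "'a \<Rightarrow> 'a \<Rightarrow> complex"
  assumes scaleC_add_right: "c *\<^sub>C (x + y) = c *\<^sub>C x + c *\<^sub>C y"
    and scaleC_add_left: "(c + d) *\<^sub>C x = c *\<^sub>C x + d *\<^sub>C x"
    and scaleC_scaleC: "c *\<^sub>C (d *\<^sub>C x) = (c * d) *\<^sub>C x"
    and scaleR_scaleC: "r *\<^sub>R x = complex_of_real r *\<^sub>C x"
    and cinner_commute: "cinner x y = cnj (cinner y x)"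
    and cinner_add_left: "cinner (x + y) z = cinner x z + cinner y z"
    and cinner_scaleC_left: "cinner (c *\<^sub>C x) y = c * cinner x y"
    and cinner_self: "cinner x x = complex_of_real ((norm x)\<^sup>2)"

lemma norm_scaleC: "norm (c *\<^sub>C x) = cmod c * norm (x :: 'h::complex_hilbert)"
proof -
  have "cinner (c *\<^sub>C x) (c *\<^sub>C x) = c * cnj c * cinner x x"
    by (metis cinner_commute cinner_scaleC_left complex_cnj_mult mult.assoc)
  then have "complex_of_real ((norm (c *\<^sub>C x))\<^sup>2)
      = complex_of_real ((cmod c * norm x)\<^sup>2)"
    by (simp add: cinner_self complex_mult_cnj cmod_power2 power_mult_distrib
        del: of_real_power)
  then have "(norm (c *\<^sub>C x))\<^sup>2 = (cmod c * norm x)\<^sup>2"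
    using of_real_eq_iff by blast
  then show ?thesis by simp
qed

definition infinite_dimensional :: "'h::complex_hilbert itself \<Rightarrow> bool" where
  "infinite_dimensional _ \<longleftrightarrow>
     \<not> (\<exists>B :: 'h set. finite B \<and> module.span scaleC B = UNIV)"

(* The elements of 'h \<Rightarrow>\<^sub>L 'h are the bounded real-linear operators; B(H) consists of
   those that are complex-linear. The operator norm is the same in both readings. *)
type_synonym 'h op = "'h \<Rightarrow>\<^sub>L 'h"

definition bounded_ops :: "'h::complex_hilbert op set" where
  "bounded_ops = {T. \<forall>c x. blinfun_apply T (c *\<^sub>C x) = c *\<^sub>C blinfun_apply T x}"

definition op_scaleC :: "complex \<Rightarrow> 'h::complex_hilbert op \<Rightarrow> 'h op" where
  "op_scaleC c T = Blinfun (\<lambda>x. c *\<^sub>C blinfun_apply T x)"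

lemma op_scaleC_apply: "blinfun_apply (op_scaleC c T) x = c *\<^sub>C blinfun_apply T x"
proof -
  have "bounded_linear (\<lambda>x. c *\<^sub>C blinfun_apply T x)"
  proof (rule bounded_linear_intro[where K = "cmod c * norm T"])
    show "norm (c *\<^sub>C blinfun_apply T x) \<le> norm x * (cmod c * norm T)" for x
      using mult_left_mono[OF norm_blinfun[of T x], of "cmod c"]
      by (simp add: norm_scaleC mult_ac)
    show "c *\<^sub>C blinfun_apply T (r *\<^sub>R x) = r *\<^sub>R (c *\<^sub>C blinfun_apply T x)" for r x
      unfolding blinfun.scaleR_right by (simp add: scaleR_scaleC scaleC_scaleC mult.commute)
  qed (simp add: blinfun.add_right scaleC_add_right)
  then show ?thesis
    by (simp add: op_scaleC_def bounded_linear_Blinfun_apply)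
qed

definition op_adjoint :: "'h::complex_hilbert op \<Rightarrow> 'h op" where
  "op_adjoint T = (THE S. \<forall>x y.
     cinner (blinfun_apply T x) y = cinner x (blinfun_apply S y))"

(* Tuples in B(H)^n are vectors indexed by a finite type 'n with n = CARD('n). *)
definition nc_ball :: "('h::complex_hilbert op ^ 'n::finite) set" where
  "nc_ball = {X. (\<forall>i. X $ i \<in> bounded_ops) \<and>
     sqrt (norm (\<Sum>i\<in>UNIV. X $ i o\<^sub>L op_adjoint (X $ i))) < 1}"

(* The free semigroup on the generators indexed by 'n is 'n list: the identity is [],
   the product is concatenation, and the length of a word is the length of the list. *)
primrec word_op :: "'h::complex_hilbert op ^ 'n::finite \<Rightarrow> 'n list \<Rightarrow> 'h op" where
  "word_op X [] = id_blinfun"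
| "word_op X (i # \<alpha>) = X $ i o\<^sub>L word_op X \<alpha>"

definition homogeneous_part ::
    "('n::finite list \<Rightarrow> complex) \<Rightarrow> nat \<Rightarrow> 'h::complex_hilbert op ^ 'n \<Rightarrow> 'h op" where
  "homogeneous_part a k X = (\<Sum>\<alpha> | length \<alpha> = k. op_scaleC (a \<alpha>) (word_op X \<alpha>))"

(* Functions on the ball are total functions whose values off nc_ball are irrelevant. *)
definition has_free_series ::
    "('h::complex_hilbert op ^ 'n::finite \<Rightarrow> 'h op) \<Rightarrow> ('n list \<Rightarrow> complex) \<Rightarrow> bool" where
  "has_free_series f a \<longleftrightarrow>
     limsup (\<lambda>k. ereal (root (2 * k) (\<Sum>\<alpha> | length \<alpha> = k. (cmod (a \<alpha>))\<^sup>2))) \<le> 1 \<and>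
     (\<forall>X\<in>nc_ball. (\<lambda>k. homogeneous_part a k X) sums f X)"

definition free_holomorphic ::
    "('h::complex_hilbert op ^ 'n::finite \<Rightarrow> 'h op) \<Rightarrow> bool" where
  "free_holomorphic f \<longleftrightarrow> (\<exists>a. has_free_series f a)"

(* The coefficients are unique when H is infinite dimensional. *)
definition free_coeff ::
    "('h::complex_hilbert op ^ 'n::finite \<Rightarrow> 'h op) \<Rightarrow> 'n list \<Rightarrow> complex" where
  "free_coeff f = (THE a. has_free_series f a)"

definition free_holomorphic_self_map ::
    "('h::complex_hilbert op ^ 'n::finite \<Rightarrow> 'h op ^ 'n) \<Rightarrow> bool" where
  "free_holomorphic_self_map \<phi> \<longleftrightarrow>
     (\<forall>i. free_holomorphic (\<lambda>X. \<phi> X $ i)) \<and> \<phi> ` nc_ball \<subseteq> nc_ball"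

definition free_holomorphic_automorphism ::
    "('h::complex_hilbert op ^ 'n::finite \<Rightarrow> 'h op ^ 'n) \<Rightarrow> bool" where
  "free_holomorphic_automorphism \<phi> \<longleftrightarrow>
     free_holomorphic_self_map \<phi> \<and> bij_betw \<phi> nc_ball nc_ball \<and>
     free_holomorphic_self_map (inv_into nc_ball \<phi>)"

(* The point z of C^n with \<phi>(0) = (z_1 I, ..., z_n I); its norm is the Euclidean one. *)
definition value_at_zero ::
    "('h::complex_hilbert op ^ 'n::finite \<Rightarrow> 'h op ^ 'n) \<Rightarrow> complex ^ 'n" where
  "value_at_zero \<phi> = (THE z. \<forall>i. \<phi> 0 $ i = op_scaleC (z $ i) id_blinfun)"

definition comp_op ::
    "('h::complex_hilbert op ^ 'n::finite \<Rightarrow> 'h op ^ 'n) \<Rightarrow>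
     ('h op ^ 'n \<Rightarrow> 'h op) \<Rightarrow> 'h op ^ 'n \<Rightarrow> 'h op" where
  "comp_op \<phi> f = (\<lambda>X. \<Sum>k. homogeneous_part (free_coeff f) k (\<phi> X))"

definition H2_ball :: "('h::complex_hilbert op ^ 'n::finite \<Rightarrow> 'h op) set" where
  "H2_ball = {f. free_holomorphic f \<and>
     (\<lambda>\<alpha>. (cmod (free_coeff f \<alpha>))\<^sup>2) summable_on UNIV}"

definition H2_norm :: "('h::complex_hilbert op ^ 'n::finite \<Rightarrow> 'h op) \<Rightarrow> real" where
  "H2_norm f = sqrt (\<Sum>\<^sub>\<infinity>\<alpha>. (cmod (free_coeff f \<alpha>))\<^sup>2)"

definition H2_opnorm ::
    "(('h::complex_hilbert op ^ 'n::finite \<Rightarrow> 'h op) \<Rightarrow> ('h op ^ 'n \<Rightarrow> 'h op)) \<Rightarrow> real" where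
  "H2_opnorm T = (SUP f \<in> {f \<in> H2_ball. H2_norm f \<le> 1}. H2_norm (T f))"

end

theory Submission
  imports Defs
begin

text \<open>
  Compressed creation operators on Fock space lie in the ball, so applying a self map \<open>\<phi>\<close> to them shows
  that left multiplication by the row \<open>[\<phi>\<^sub>1, \<dots>, \<phi>\<^sub>n]\<close> is a contraction \<open>M\<close> on \<open>\<ell>\<^sup>2\<close> of the free semigroup.
  Its adjoint maps the constant \<open>1\<close> to the conjugate of \<open>z = \<phi>(0)\<close>; hence, with the linear form
  \<open>\<ell> = \<Sum> cnj z\<^sub>i X\<^sub>i\<close>, the constant \<open>(1 - \<ell>) \<circ> \<phi>\<close> is the defect \<open>1 - M M\<^sup>*\<close> applied to \<open>1\<close>, and induction on
  the degree gives \<open>\<parallel>(g (1 - \<ell>)) \<circ> \<phi>\<parallel>\<^sup>2 \<le> (1 - |z|\<^sup>2) \<parallel>g\<parallel>\<^sup>2\<close>. Since right multiplication by \<open>\<ell>\<close> has norm \<open>|z|\<close>,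
  taking \<open>g = f (1 - \<ell>)\<^sup>-\<^sup>1\<close> yields the upper bound \<open>(1 - |z|\<^sup>2) / (1 - |z|)\<^sup>2\<close> for \<open>\<parallel>C\<^sub>\<phi>\<parallel>\<^sup>2\<close>. Evaluating
  the same inequality on Szego kernels at scalar points gives a Schwarz-Pick inequality. Applied to \<open>\<phi>\<close>
  and to its inverse \<open>\<psi>\<close>, it gives \<open>|\<psi>(0)| = |\<phi>(0)|\<close>, so that the lower bound follows from the upper bound for
  \<open>\<psi>\<close>, and it shows that the Szego kernels attain the constant in the limit as the point tends to the
  sphere in the direction \<open>- \<psi>(0)\<close>.
\<close>

section \<open>Complex Hilbert spaces and row contractions\<close>

text \<open>The obstacle is that f \<circ> \<phi> has no coefficients to estimate until it is known
  to be a free series. Therefore the estimates are made on formal series: norms are truncated to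
  words of length below N, compositions to the part of f of degree below d, and the bounds depend on
  neither N nor d. The composition with an infinite f is then obtained as a limit. The adjoint of M
  sends 1 to the conjugate of z because the constant coefficient of M \<eta> is the sum of z_i times
  the constant coefficient of \<eta>_i; applying M once more gives \<Sum> conj z_i \<phi>_i = \<ell>
  \<circ> \<phi>. The constant 1 - |z|^2 is the inner product of the defect of 1 with 1. For a self
  map all of this gives inequalities in one direction; invertibility enters by applying the same
  inequalities to the inverse.\<close>

interpretation cvec: vector_space "scaleC :: complex \<Rightarrow> 'h::complex_hilbert \<Rightarrow> 'h"
proof
  show "1 *\<^sub>C x = x" for x :: 'h
    using scaleR_scaleC[of 1 x] by simp
qed (simp_all add: scaleC_add_right scaleC_add_left scaleC_scaleC)

lemma cinner_add_right: "cinner x (y + z) = cinner x y + cinner x (z :: 'h::complex_hilbert)"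
  by (metis cinner_add_left cinner_commute complex_cnj_add)

lemma cinner_scaleC_right: "cinner x (c *\<^sub>C y) = cnj c * cinner x (y :: 'h::complex_hilbert)"
  by (metis cinner_scaleC_left cinner_commute complex_cnj_mult)

lemma cinner_zero_left [simp]: "cinner 0 (y :: 'h::complex_hilbert) = 0"
  using cinner_scaleC_left[of 0 0 y] by simp

lemma cinner_zero_right [simp]: "cinner (y :: 'h::complex_hilbert) 0 = 0"
  by (subst cinner_commute) simp

lemma cinner_diff_left: "cinner (x - z) y = cinner x y - cinner z (y :: 'h::complex_hilbert)"
  using cinner_add_left[of "x - z" z y] by simp

lemma cinner_diff_right: "cinner x (y - z) = cinner x y - cinner x (z :: 'h::complex_hilbert)"
  using cinner_add_right[of x "y - z" z] by simp

lemma cinner_sum_left: "cinner (\<Sum>i\<in>A. f i) y = (\<Sum>i\<in>A. cinner (f i) (y :: 'h::complex_hilbert))"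
  by (induction A rule: infinite_finite_induct) (auto simp: cinner_add_left)

lemma cinner_sum_right: "cinner y (\<Sum>i\<in>A. f i) = (\<Sum>i\<in>A. cinner (y :: 'h::complex_hilbert) (f i))"
  by (induction A rule: infinite_finite_induct) (auto simp: cinner_add_right)

lemma norm_add_sq:
  "(norm (x + y :: 'h::complex_hilbert))\<^sup>2 = (norm x)\<^sup>2 + (norm y)\<^sup>2 + 2 * Re (cinner x y)"
proof -
  have "complex_of_real ((norm (x + y))\<^sup>2) = cinner (x + y) (x + y)"
    by (simp add: cinner_self)
  also have "\<dots> = cinner x x + cinner y y + (cinner x y + cnj (cinner x y))"
    using cinner_commute[of y x] by (simp add: cinner_add_left cinner_add_right)
  also have "\<dots> = complex_of_real ((norm x)\<^sup>2 + (norm y)\<^sup>2 + 2 * Re (cinner x y))"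
    by (simp add: cinner_self complex_add_cnj)
  finally show ?thesis
    using of_real_eq_iff by blast
qed

lemma norm_diff_sq:
  "(norm (x - y :: 'h::complex_hilbert))\<^sup>2 = (norm x)\<^sup>2 + (norm y)\<^sup>2 - 2 * Re (cinner x y)"
  using norm_add_sq[of "x - y" y] cinner_self[of y] by (simp add: cinner_diff_left)

lemma cinner_cauchy_schwarz: "cmod (cinner x y) \<le> norm x * norm (y :: 'h::complex_hilbert)"
proof (cases "y = 0")
  case False
  define c where "c = cinner x y / complex_of_real ((norm y)\<^sup>2)"
  have ny: "(norm y)\<^sup>2 > 0" using False by simp
  have c: "cmod c = cmod (cinner x y) / (norm y)\<^sup>2"
    by (simp add: c_def norm_divide norm_power)
  have e: "cinner x (c *\<^sub>C y) = complex_of_real ((cmod (cinner x y))\<^sup>2 / (norm y)\<^sup>2)"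
    unfolding cinner_scaleC_right c_def
    by (simp add: complex_norm_square[symmetric] mult.commute)
  have "0 \<le> (norm (x - c *\<^sub>C y))\<^sup>2" by simp
  also have "\<dots> = (norm x)\<^sup>2 + (cmod c * norm y)\<^sup>2 - 2 * ((cmod (cinner x y))\<^sup>2 / (norm y)\<^sup>2)"
    unfolding norm_diff_sq norm_scaleC e by simp
  also have "\<dots> = (norm x)\<^sup>2 - (cmod (cinner x y))\<^sup>2 / (norm y)\<^sup>2"
    using False unfolding c by (simp add: power_mult_distrib power_divide field_simps power4_eq_xxxx power2_eq_square)
  finally have "(cmod (cinner x y))\<^sup>2 \<le> (norm x * norm y)\<^sup>2"
    using ny by (simp add: field_simps power_mult_distrib)
  then show ?thesis
    by (rule power2_le_imp_le) simp
qed simp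

lemma bounded_linear_cinner_left: "bounded_linear (\<lambda>x. cinner x (y :: 'h::complex_hilbert))"
  by (rule bounded_linear_intro[where K = "norm y"])
    (simp_all add: cinner_add_left scaleR_scaleC cinner_scaleC_left cinner_cauchy_schwarz scaleR_conv_of_real)

lemma cinner_eqI:
  assumes "\<And>x. cinner x y = cinner x (z :: 'h::complex_hilbert)"
  shows "y = z"
proof -
  have "cinner (y - z) (y - z) = 0"
    using assms by (simp add: cinner_diff_right)
  then show ?thesis
    by (simp add: cinner_self)
qed

text \<open>The representing vector minimises the functional \<open>x \<mapsto> \<parallel>x\<parallel>\<^sup>2 - 2 Re (f x)\<close>, whose minimising
  sequences are Cauchy by the parallelogram law.\<close>

lemma riesz_representation:
  fixes f :: "'h::complex_hilbert \<Rightarrow> complex"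
  assumes bl: "bounded_linear f" and fc: "\<And>c x. f (c *\<^sub>C x) = c * f x"
  shows "\<exists>y. \<forall>x. f x = cinner x y"
proof -
  interpret f: bounded_linear f by (rule bl)
  obtain K where K: "\<And>x. cmod (f x) \<le> norm x * K" using f.bounded by blast
  define F where "F x = (norm x)\<^sup>2 - 2 * Re (f x)" for x
  have lower: "F x \<ge> - K\<^sup>2" for x
  proof -
    have "Re (f x) \<le> norm x * K"
      using K[of x] complex_Re_le_cmod[of "f x"] by linarith
    moreover have "0 \<le> (norm x - K)\<^sup>2" by simp
    ultimately show ?thesis
      unfolding F_def power2_diff by (simp add: mult.assoc)
  qed
  have bdd: "bdd_below (range F)"
    by (rule bdd_belowI2[OF lower])
  define m where "m = (INF x. F x)"
  have mF: "m \<le> F x" for x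
    unfolding m_def by (rule cINF_lower[OF bdd]) simp
  have "\<exists>x. F x < m + 1 / real (Suc n)" for n
  proof -
    have "m < m + 1 / real (Suc n)" by simp
    then show ?thesis
      using cINF_less_iff[of UNIV F "m + 1 / real (Suc n)"] bdd unfolding m_def by auto
  qed
  then obtain u where u: "\<And>n. F (u n) < m + 1 / real (Suc n)" by metis
  have par: "(norm (x - y))\<^sup>2 \<le> 2 * (F x - m) + 2 * (F y - m)" for x y
  proof -
    have half: "F ((1/2) *\<^sub>R (x + y)) = (norm (x + y))\<^sup>2 / 4 - Re (f x) - Re (f y)"
      unfolding F_def by (simp add: f.scaleR f.add power2_eq_square add_divide_distrib)
    have "(norm (x - y))\<^sup>2 + (norm (x + y))\<^sup>2 = 2 * (norm x)\<^sup>2 + 2 * (norm y)\<^sup>2"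
      by (simp add: norm_add_sq norm_diff_sq)
    with half mF[of "(1/2) *\<^sub>R (x + y)"] show ?thesis
      unfolding F_def by argo
  qed
  have "Cauchy u"
  proof (rule metric_CauchyI)
    fix e :: real assume e: "e > 0"
    obtain M where M: "4 / e\<^sup>2 < real M" using reals_Archimedean2 by blast
    show "\<exists>M. \<forall>k\<ge>M. \<forall>n\<ge>M. dist (u k) (u n) < e"
    proof (intro exI allI impI)
      fix k n assume kn: "k \<ge> M" "n \<ge> M"
      have small: "F (u j) - m < e\<^sup>2 / 4" if "j \<ge> M" for j
      proof -
        have "4 / e\<^sup>2 < real (Suc j)" using M that by linarith
        then have "1 / real (Suc j) < e\<^sup>2 / 4"
          using e by (simp add: field_simps)
        then show ?thesis using u[of j] by linarith
      qed
      have "(norm (u k - u n))\<^sup>2 < e\<^sup>2"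
        using par[of "u k" "u n"] small[OF kn(1)] small[OF kn(2)] by argo
      then show "dist (u k) (u n) < e"
        using e by (simp add: dist_norm power2_less_imp_less)
    qed
  qed
  then obtain y where y: "u \<longlonglongrightarrow> y"
    using Cauchy_convergent_iff convergent_def by blast
  have "(\<lambda>n. F (u n)) \<longlonglongrightarrow> F y"
    unfolding F_def by (intro tendsto_intros y f.tendsto)
  moreover have "(\<lambda>n. m + 1 / real (Suc n)) \<longlonglongrightarrow> m"
    using tendsto_add[OF tendsto_const[of m] LIMSEQ_inverse_real_of_nat] by (simp add: inverse_eq_divide)
  ultimately have Fy: "F y \<le> m"
    using u by (intro LIMSEQ_le) (auto intro: less_imp_le)
  have re: "Re (f x) = Re (cinner x y)" for x
  proof -
    have ineq: "0 \<le> t\<^sup>2 * (norm x)\<^sup>2 + t * (2 * (Re (cinner x y) - Re (f x)))" for t :: real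
    proof -
      have "F y \<le> F (y + t *\<^sub>R x)" using Fy mF[of "y + t *\<^sub>R x"] by linarith
      moreover have "Re (cinner y (t *\<^sub>R x)) = t * Re (cinner x y)"
        by (subst cinner_commute) (simp add: scaleR_scaleC cinner_scaleC_left)
      ultimately show ?thesis
        unfolding F_def norm_add_sq by (simp add: f.add f.scaleR algebra_simps power_mult_distrib)
    qed
    define b where "b = Re (cinner x y) - Re (f x)"
    \<comment> \<open>A quadratic in t without constant term that is nonnegative for all t has
      linear coefficient 0; this is tested at t = - b / s. The added 1 keeps s positive when x =
      0.\<close>
    define s where "s = (norm x)\<^sup>2 + 1"
    have s: "s \<ge> 1" "(norm x)\<^sup>2 \<le> s" unfolding s_def by simp_all
    have "0 \<le> (- b / s)\<^sup>2 * (norm x)\<^sup>2 + (- b / s) * (2 * b)"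
      using ineq[of "- b / s"] unfolding b_def .
    also have "\<dots> \<le> (- b / s)\<^sup>2 * s + (- b / s) * (2 * b)"
      using s by (intro add_right_mono mult_left_mono) auto
    also have "\<dots> = - (b\<^sup>2 / s)"
      using s by (simp add: power2_eq_square field_simps)
    finally have "b\<^sup>2 / s \<le> 0" by simp
    moreover have "0 \<le> b\<^sup>2 / s" using s by simp
    ultimately have "b\<^sup>2 / s = 0" by linarith
    then have "b = 0" using s by (auto simp: divide_eq_0_iff)
    then show ?thesis unfolding b_def by simp
  qed
  \<comment> \<open>The real part at \<i> x is minus the imaginary part at x, so the identity of
    real parts at both points gives the complex one.\<close>
  have "f x = cinner x y" for x
    using re[of x] re[of "\<i> *\<^sub>C x"] by (simp add: complex_eq_iff fc cinner_scaleC_left)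
  then show ?thesis by blast
qed

text \<open>\<open>op_adjoint\<close> is a definite description, so existence (Riesz, for each y)
  and uniqueness must be settled before it can be used.\<close>

lemma op_adjoint_cinner:
  fixes T :: "'h::complex_hilbert op"
  assumes T: "T \<in> bounded_ops"
  shows "cinner (blinfun_apply T x) y = cinner x (blinfun_apply (op_adjoint T) y)"
proof -
  have "\<exists>z. \<forall>x. cinner (blinfun_apply T x) y = cinner x z" for y
  proof (rule riesz_representation)
    show "bounded_linear (\<lambda>x. cinner (blinfun_apply T x) y)"
      by (rule bounded_linear_compose[OF bounded_linear_cinner_left blinfun.bounded_linear_right])
    show "cinner (blinfun_apply T (c *\<^sub>C x)) y = c * cinner (blinfun_apply T x) y" for c x
      using T by (simp add: bounded_ops_def cinner_scaleC_left)
  qed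
  then obtain s where s: "\<And>x y. cinner (blinfun_apply T x) y = cinner x (s y)" by metis
  have "bounded_linear s"
  proof (rule bounded_linear_intro[where K = "norm T"])
    show "s (x + y) = s x + s y" for x y
      by (rule cinner_eqI) (simp add: s[symmetric] cinner_add_right)
    show "s (r *\<^sub>R x) = r *\<^sub>R s x" for r x
      by (rule cinner_eqI) (simp add: s[symmetric] scaleR_scaleC cinner_scaleC_right)
    show "norm (s x) \<le> norm x * norm T" for x
    proof (cases "s x = 0")
      case False
      have "(norm (s x))\<^sup>2 = cmod (cinner (s x) (s x))"
        by (simp add: cinner_self norm_power)
      also have "\<dots> \<le> norm (blinfun_apply T (s x)) * norm x"
        unfolding s[symmetric] by (rule cinner_cauchy_schwarz)
      also have "\<dots> \<le> (norm T * norm (s x)) * norm x"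
        by (intro mult_right_mono norm_blinfun) simp
      finally show ?thesis using False by (simp add: power2_eq_square mult_ac)
    qed simp
  qed
  then have s': "\<forall>x y. cinner (blinfun_apply T x) y = cinner x (blinfun_apply (Blinfun s) y)"
    by (simp add: s bounded_linear_Blinfun_apply)
  have "\<forall>x y. cinner (blinfun_apply T x) y = cinner x (blinfun_apply (op_adjoint T) y)"
    unfolding op_adjoint_def
  proof (rule theI[where P = "\<lambda>S. \<forall>x y. cinner (blinfun_apply T x) y = cinner x (blinfun_apply S y)"])
    show "\<forall>x y. cinner (blinfun_apply T x) y = cinner x (blinfun_apply (Blinfun s) y)" by (rule s')
    fix S assume "\<forall>x y. cinner (blinfun_apply T x) y = cinner x (blinfun_apply S y)"
    with s' show "S = Blinfun s" by (intro blinfun_eqI cinner_eqI) metis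
  qed
  then show ?thesis by blast
qed

lemma row_adjoint_cinner:
  fixes X :: "'h::complex_hilbert op ^ 'n::finite"
  assumes "\<And>i. X $ i \<in> bounded_ops"
  shows "cinner (\<Sum>i\<in>UNIV. blinfun_apply (X $ i) (\<eta> i)) y
    = (\<Sum>i\<in>UNIV. cinner (\<eta> i) (blinfun_apply (op_adjoint (X $ i)) y))"
  by (simp add: cinner_sum_left op_adjoint_cinner assms)

lemma row_sum_cinner_self:
  fixes X :: "'h::complex_hilbert op ^ 'n::finite"
  assumes "\<And>i. X $ i \<in> bounded_ops"
  shows "cinner (blinfun_apply (\<Sum>i\<in>UNIV. X $ i o\<^sub>L op_adjoint (X $ i)) y) y
    = complex_of_real (\<Sum>i\<in>UNIV. (norm (blinfun_apply (op_adjoint (X $ i)) y))\<^sup>2)"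
  using row_adjoint_cinner[OF assms, of "\<lambda>i. blinfun_apply (op_adjoint (X $ i)) y" y]
  by (simp add: blinfun.sum_left cinner_self)

lemma sum_norm_mult_le:
  fixes f :: "'i \<Rightarrow> 'a::real_normed_vector" and g :: "'i \<Rightarrow> 'b::real_normed_vector"
  shows "(\<Sum>i\<in>A. norm (f i) * norm (g i)) \<le> sqrt (\<Sum>i\<in>A. (norm (f i))\<^sup>2) * sqrt (\<Sum>i\<in>A. (norm (g i))\<^sup>2)"
  using L2_set_mult_ineq[of "\<lambda>i. norm (f i)" "\<lambda>i. norm (g i)" A] by (simp add: L2_set_def)

text \<open>With R the row operator that sends \<eta> to \<Sum> X_i \<eta>_i, the sum in
  \<open>nc_ball\<close> is R R*, whose norm is the square of the norm of R. Later proofs work with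
  the row bound and no adjoint.\<close>

lemma nc_ball_iff:
  fixes X :: "'h::complex_hilbert op ^ 'n::finite"
  shows "X \<in> nc_ball \<longleftrightarrow> (\<forall>i. X $ i \<in> bounded_ops) \<and>
    (\<exists>\<rho>\<ge>0. \<rho> < 1 \<and> (\<forall>\<eta>. norm (\<Sum>i\<in>UNIV. blinfun_apply (X $ i) (\<eta> i))
       \<le> \<rho> * sqrt (\<Sum>i\<in>UNIV. (norm (\<eta> i))\<^sup>2)))"
    (is "?L \<longleftrightarrow> ?B \<and> ?R")
proof (cases ?B)
  case True
  then have B: "\<And>i. X $ i \<in> bounded_ops" by blast
  define P where "P = (\<Sum>i\<in>UNIV. X $ i o\<^sub>L op_adjoint (X $ i))"
  define A where "A i = blinfun_apply (op_adjoint (X $ i))" for i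
  define row where "row \<eta> = (\<Sum>i\<in>UNIV. blinfun_apply (X $ i) (\<eta> i))" for \<eta>
  have P: "cinner (blinfun_apply P y) y = complex_of_real (\<Sum>i\<in>UNIV. (norm (A i y))\<^sup>2)" for y
    unfolding P_def A_def by (rule row_sum_cinner_self[OF B])
  have Prow: "blinfun_apply P y = row (\<lambda>i. A i y)" for y
    by (simp add: P_def row_def A_def blinfun.sum_left)
  have Pnorm: "(\<Sum>i\<in>UNIV. (norm (A i y))\<^sup>2) \<le> norm (blinfun_apply P y) * norm y" for y
  proof -
    have "(\<Sum>i\<in>UNIV. (norm (A i y))\<^sup>2) = cmod (cinner (blinfun_apply P y) y)"
      unfolding P norm_of_real by (simp add: sum_nonneg)
    then show ?thesis using cinner_cauchy_schwarz[of "blinfun_apply P y" y] by simp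
  qed
  have "?L \<longleftrightarrow> ?R"
  proof
    assume ?L
    then have N: "sqrt (norm P) < 1" by (simp add: nc_ball_def P_def)
    define \<rho> where "\<rho> = sqrt (norm P)"
    have "norm (row \<eta>) \<le> \<rho> * sqrt (\<Sum>i\<in>UNIV. (norm (\<eta> i))\<^sup>2)" for \<eta>
    proof (cases "row \<eta> = 0")
      case True
      then show ?thesis by (simp add: \<rho>_def sum_nonneg)
    next
      case False
      have a: "sqrt (\<Sum>i\<in>UNIV. (norm (A i y))\<^sup>2) \<le> \<rho> * norm y" for y
      proof (rule real_le_lsqrt)
        have "(\<Sum>i\<in>UNIV. (norm (A i y))\<^sup>2) \<le> (norm P * norm y) * norm y"
          by (rule order.trans[OF Pnorm]) (intro mult_right_mono norm_blinfun norm_ge_zero)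
        then show "(\<Sum>i\<in>UNIV. (norm (A i y))\<^sup>2) \<le> (\<rho> * norm y)\<^sup>2"
          by (simp add: \<rho>_def power_mult_distrib) (simp add: power2_eq_square mult_ac)
      qed (simp add: \<rho>_def)
      have "(norm (row \<eta>))\<^sup>2 = cmod (cinner (row \<eta>) (row \<eta>))"
        by (simp add: cinner_self norm_power)
      also have "cinner (row \<eta>) (row \<eta>) = (\<Sum>i\<in>UNIV. cinner (\<eta> i) (A i (row \<eta>)))"
        unfolding A_def row_def by (rule row_adjoint_cinner[OF B])
      also have "cmod \<dots> \<le> (\<Sum>i\<in>UNIV. norm (\<eta> i) * norm (A i (row \<eta>)))"
        by (rule order.trans[OF norm_sum]) (intro sum_mono cinner_cauchy_schwarz)
      also have "\<dots> \<le> sqrt (\<Sum>i\<in>UNIV. (norm (\<eta> i))\<^sup>2) * sqrt (\<Sum>i\<in>UNIV. (norm (A i (row \<eta>)))\<^sup>2)"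
        by (rule sum_norm_mult_le)
      also have "\<dots> \<le> sqrt (\<Sum>i\<in>UNIV. (norm (\<eta> i))\<^sup>2) * (\<rho> * norm (row \<eta>))"
        by (intro mult_left_mono a) (simp add: sum_nonneg)
      finally show ?thesis using False by (simp add: power2_eq_square mult_ac)
    qed
    then show ?R
      using N unfolding row_def \<rho>_def by (intro exI[of _ "sqrt (norm P)"]) simp
  next
    assume ?R
    then obtain \<rho> where \<rho>: "\<rho> \<ge> 0" "\<rho> < 1"
      and R: "\<And>\<eta>. norm (row \<eta>) \<le> \<rho> * sqrt (\<Sum>i\<in>UNIV. (norm (\<eta> i))\<^sup>2)"
      unfolding row_def by blast
    \<comment> \<open>The bounds |P y| \<le> \<rho> |R* y| and |R* y|^2 \<le> |P y| |y| combine to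
      the claim after a factor |P y| is cancelled, which is why P y = 0 is set apart.\<close>
    have "norm (blinfun_apply P y) \<le> \<rho>\<^sup>2 * norm y" for y
    proof (cases "blinfun_apply P y = 0")
      case False
      have "(norm (blinfun_apply P y))\<^sup>2 \<le> (\<rho> * sqrt (\<Sum>i\<in>UNIV. (norm (A i y))\<^sup>2))\<^sup>2"
        unfolding Prow by (intro power_mono R) simp
      also have "\<dots> = \<rho>\<^sup>2 * (\<Sum>i\<in>UNIV. (norm (A i y))\<^sup>2)"
        by (simp add: power_mult_distrib sum_nonneg)
      also have "\<dots> \<le> \<rho>\<^sup>2 * (norm (blinfun_apply P y) * norm y)"
        by (intro mult_left_mono Pnorm) simp
      finally show ?thesis using False by (simp add: power2_eq_square mult_ac)
    qed (simp add: \<rho>)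
    then have "norm P \<le> \<rho>\<^sup>2"
      by (intro norm_blinfun_bound) (simp_all add: \<rho>)
    also have "\<dots> < 1" using \<rho> by (simp add: power_less_one_iff abs_square_less_1)
    finally show ?L using B by (simp add: nc_ball_def P_def)
  qed
  with True show ?thesis by blast
qed (auto simp: nc_ball_def)

text \<open>Gram-Schmidt: in infinite dimension a vector outside the span of finitely many others
  always exists. Finite families are enough because the Fock space is used in truncated
  form.\<close>

lemma exists_orthonormal:
  assumes inf: "infinite_dimensional TYPE('h::complex_hilbert)" and "finite A"
  shows "\<exists>e :: 'a \<Rightarrow> 'h. \<forall>x\<in>A. \<forall>y\<in>A. cinner (e x) (e y) = (if x = y then 1 else 0)"
  using \<open>finite A\<close>
proof (induction A)
  case (insert a A)
  then obtain e :: "'a \<Rightarrow> 'h" where e: "\<And>x y. x \<in> A \<Longrightarrow> y \<in> A \<Longrightarrow> cinner (e x) (e y) = (if x = y then 1 else 0)"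
    by blast
  have "cvec.span (e ` A) \<noteq> UNIV"
    using inf insert.hyps unfolding infinite_dimensional_def by blast
  then obtain v where v: "v \<notin> cvec.span (e ` A)" by blast
  define w where "w = v - (\<Sum>b\<in>A. cinner v (e b) *\<^sub>C e b)"
  have "w \<noteq> 0"
  proof
    assume "w = 0"
    then have "v = (\<Sum>b\<in>A. cinner v (e b) *\<^sub>C e b)" by (simp add: w_def)
    also have "\<dots> \<in> cvec.span (e ` A)"
      by (intro cvec.span_sum cvec.span_scale cvec.span_base) auto
    finally show False using v by simp
  qed
  have wx: "cinner w (e x) = 0" if "x \<in> A" for x
  proof -
    have "cinner w (e x) = cinner v (e x) - (\<Sum>b\<in>A. cinner v (e b) * (if b = x then 1 else 0))"
      unfolding w_def using that by (simp add: cinner_diff_left cinner_sum_left cinner_scaleC_left e)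
    then show ?thesis using that insert.hyps by (simp add: if_distrib cong: if_cong)
  qed
  then have xw: "cinner (e x) w = 0" if "x \<in> A" for x
    by (subst cinner_commute) (simp add: that)
  define u where "u = complex_of_real (1 / norm w) *\<^sub>C w"
  have "cinner u u = 1"
    using \<open>w \<noteq> 0\<close> unfolding cinner_self u_def norm_scaleC by (simp add: norm_divide)
  moreover have "cinner u (e x) = 0" "cinner (e x) u = 0" if "x \<in> A" for x
    using that by (simp_all add: u_def cinner_scaleC_left cinner_scaleC_right wx xw)
  ultimately show ?case
    using insert.hyps e by (intro exI[of _ "e(a := u)"]) auto
qed simp

section \<open>Truncated creation operators and multipliers\<close>

definition words :: "nat \<Rightarrow> 'n::finite list set" where
  "words N = {\<alpha>. length \<alpha> < N}"

lemma in_words_iff [simp]: "\<alpha> \<in> words N \<longleftrightarrow> length \<alpha> < N"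
  by (simp add: words_def)

lemma finite_words_eq [simp]: "finite {\<alpha> :: 'n::finite list. length \<alpha> = k}"
  using finite_lists_length_eq[of "UNIV :: 'n set" k] by simp

lemma finite_words [simp]: "finite (words N :: 'n::finite list set)"
  by (rule finite_subset[OF _ finite_lists_length_le[of UNIV N]]) (auto simp: words_def)

lemma words_0 [simp]: "words 0 = {}"
  by (simp add: words_def)

lemma sum_words_eq_Suc:
  "(\<Sum>\<alpha> | length \<alpha> = Suc k. F (\<alpha> :: 'n::finite list)) = (\<Sum>i\<in>UNIV. \<Sum>\<alpha> | length \<alpha> = k. F (i # \<alpha>))"
proof -
  have "(\<Sum>i\<in>UNIV. \<Sum>\<alpha> | length \<alpha> = k. F (i # \<alpha>)) = (\<Sum>(i, \<alpha>)\<in>UNIV \<times> {\<alpha>. length \<alpha> = k}. F (i # \<alpha>))"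
    by (simp add: sum.cartesian_product)
  also have "\<dots> = (\<Sum>\<alpha> | length \<alpha> = Suc k. F \<alpha>)"
    by (rule sum.reindex_bij_witness[where j = "\<lambda>(i, \<alpha>). i # \<alpha>" and i = "\<lambda>\<alpha>. (hd \<alpha>, tl \<alpha>)"])
      (auto simp: length_Suc_conv)
  finally show ?thesis by simp
qed

lemma sum_words_Suc:
  "(\<Sum>\<alpha>\<in>words (Suc N). F (\<alpha> :: 'n::finite list)) = F [] + (\<Sum>i\<in>UNIV. \<Sum>\<alpha>\<in>words N. F (i # \<alpha>))"
proof -
  have "(\<Sum>i\<in>UNIV. \<Sum>\<alpha>\<in>words N. F (i # \<alpha>)) = (\<Sum>(i, \<alpha>)\<in>UNIV \<times> words N. F (i # \<alpha>))"
    by (simp add: sum.cartesian_product)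
  also have "\<dots> = (\<Sum>\<alpha>\<in>words (Suc N) - {[]}. F \<alpha>)"
    by (rule sum.reindex_bij_witness[where j = "\<lambda>(i, \<alpha>). i # \<alpha>" and i = "\<lambda>\<alpha>. (hd \<alpha>, tl \<alpha>)"])
      (auto simp: words_def neq_Nil_conv)
  finally show ?thesis
    by (subst sum.remove[of "words (Suc N)" "[]"]) simp_all
qed

lemma sum_words_by_length:
  "(\<Sum>\<alpha>\<in>words N. F (\<alpha> :: 'n::finite list)) = (\<Sum>k<N. \<Sum>\<alpha> | length \<alpha> = k. F \<alpha>)"
proof -
  have "(\<Sum>\<alpha>\<in>words N. F \<alpha>) = (\<Sum>k<N. \<Sum>\<alpha> | \<alpha> \<in> words N \<and> length \<alpha> = k. F \<alpha>)"
    by (rule sum.group[symmetric]) auto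
  also have "\<dots> = (\<Sum>k<N. \<Sum>\<alpha> | length \<alpha> = k. F \<alpha>)"
    by (intro sum.cong refl) (auto simp: words_def)
  finally show ?thesis .
qed

definition nsq :: "nat \<Rightarrow> ('n::finite list \<Rightarrow> complex) \<Rightarrow> real" where
  "nsq N g = (\<Sum>\<alpha>\<in>words N. (cmod (g \<alpha>))\<^sup>2)"

text \<open>Product of formal power series in noncommuting variables. A coefficient of the product
  involves only coefficients at words that are no longer, so it is compatible with truncated
  norms.\<close>

definition convolve :: "('n list \<Rightarrow> complex) \<Rightarrow> ('n list \<Rightarrow> complex) \<Rightarrow> 'n list \<Rightarrow> complex" where
  "convolve p g \<gamma> = (\<Sum>m\<le>length \<gamma>. p (take m \<gamma>) * g (drop m \<gamma>))"

definition unit_series :: "'n list \<Rightarrow> complex" where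
  "unit_series \<gamma> = (if \<gamma> = [] then 1 else 0)"

lemma convolve_unit_series [simp]: "convolve p unit_series = p"
proof
  fix \<gamma> :: "'a list"
  have "convolve p unit_series \<gamma> = (\<Sum>m\<le>length \<gamma>. if m = length \<gamma> then p (take m \<gamma>) else 0)"
    unfolding convolve_def by (intro sum.cong refl) (auto simp: unit_series_def)
  then show "convolve p unit_series \<gamma> = p \<gamma>" by simp
qed

lemma orthonormal_expansion:
  fixes e :: "'a \<Rightarrow> 'h::complex_hilbert"
  assumes A: "finite A" and e: "\<And>x y. x \<in> A \<Longrightarrow> y \<in> A \<Longrightarrow> cinner (e x) (e y) = (if x = y then 1 else 0)"
  shows "y \<in> A \<Longrightarrow> cinner (\<Sum>x\<in>A. g x *\<^sub>C e x) (e y) = g y"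
    and "(norm (\<Sum>x\<in>A. g x *\<^sub>C e x))\<^sup>2 = (\<Sum>x\<in>A. (cmod (g x))\<^sup>2)"
    and "(\<Sum>x\<in>A. (cmod (cinner v (e x)))\<^sup>2) \<le> (norm v)\<^sup>2"
proof -
  have coeff: "cinner (\<Sum>x\<in>A. g x *\<^sub>C e x) (e y) = g y" if "y \<in> A" for g y
  proof -
    have "cinner (\<Sum>x\<in>A. g x *\<^sub>C e x) (e y) = (\<Sum>x\<in>A. if x = y then g x else 0)"
      unfolding cinner_sum_left cinner_scaleC_left by (intro sum.cong refl) (simp add: e that)
    then show ?thesis using A that by simp
  qed
  then show "y \<in> A \<Longrightarrow> cinner (\<Sum>x\<in>A. g x *\<^sub>C e x) (e y) = g y" .
  have nrm: "(norm (\<Sum>x\<in>A. g x *\<^sub>C e x))\<^sup>2 = (\<Sum>x\<in>A. (cmod (g x))\<^sup>2)" for g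
  proof -
    have "complex_of_real ((norm (\<Sum>x\<in>A. g x *\<^sub>C e x))\<^sup>2) = (\<Sum>y\<in>A. cnj (g y) * g y)"
      unfolding cinner_self[symmetric] by (subst cinner_sum_right) (simp add: cinner_scaleC_right coeff)
    also have "\<dots> = complex_of_real (\<Sum>x\<in>A. (cmod (g x))\<^sup>2)"
      by (simp only: of_real_sum complex_norm_square) (simp add: mult.commute)
    finally show ?thesis using of_real_eq_iff by blast
  qed
  then show "(norm (\<Sum>x\<in>A. g x *\<^sub>C e x))\<^sup>2 = (\<Sum>x\<in>A. (cmod (g x))\<^sup>2)" .
  define w where "w = (\<Sum>x\<in>A. cinner v (e x) *\<^sub>C e x)"
  have "cinner v w = complex_of_real (\<Sum>x\<in>A. (cmod (cinner v (e x)))\<^sup>2)"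
    unfolding w_def cinner_sum_right cinner_scaleC_right of_real_sum complex_norm_square
    by (simp add: mult.commute)
  then have "(norm (v - w))\<^sup>2 = (norm v)\<^sup>2 - (\<Sum>x\<in>A. (cmod (cinner v (e x)))\<^sup>2)"
    unfolding norm_diff_sq by (simp add: nrm w_def)
  then show "(\<Sum>x\<in>A. (cmod (cinner v (e x)))\<^sup>2) \<le> (norm v)\<^sup>2"
    using zero_le_power2[of "norm (v - w)"] by linarith
qed

lemma bounded_linear_rank_one: "bounded_linear (\<lambda>x. (c * cinner x y) *\<^sub>C (z :: 'h::complex_hilbert))"
proof (rule bounded_linear_intro[where K = "cmod c * norm y * norm z"])
  fix x
  show "norm ((c * cinner x y) *\<^sub>C z) \<le> norm x * (cmod c * norm y * norm z)"
    using mult_left_mono[OF cinner_cauchy_schwarz[of x y], of "cmod c * norm z"]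
    by (simp add: norm_scaleC norm_mult mult_ac)
qed (simp_all add: cinner_add_left cinner_scaleC_left scaleR_scaleC scaleC_scaleC distrib_left
    scaleC_add_left mult_ac)

section \<open>Truncated Fock space inside H and its creation operators\<close>

definition comb :: "('n::finite list \<Rightarrow> 'h) \<Rightarrow> nat \<Rightarrow> ('n list \<Rightarrow> complex) \<Rightarrow> 'h::complex_hilbert" where
  "comb e N g = (\<Sum>\<alpha>\<in>words N. g \<alpha> *\<^sub>C e \<alpha>)"

lemma comb_cong:
  fixes e :: "'n::finite list \<Rightarrow> 'h::complex_hilbert"
  shows "(\<And>\<gamma>. length \<gamma> < N \<Longrightarrow> g \<gamma> = h \<gamma>) \<Longrightarrow> comb e N g = comb e N h"
  unfolding comb_def by (intro sum.cong) (auto simp: words_def)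

lemma scaleC_comb:
  fixes e :: "'n::finite list \<Rightarrow> 'h::complex_hilbert"
  shows "c *\<^sub>C comb e N g = comb e N (\<lambda>\<gamma>. c * g \<gamma>)"
  by (simp add: comb_def cvec.scale_sum_right)

lemma sum_comb:
  fixes e :: "'n::finite list \<Rightarrow> 'h::complex_hilbert"
  shows "(\<Sum>x\<in>A. comb e N (g x)) = comb e N (\<lambda>\<gamma>. \<Sum>x\<in>A. g x \<gamma>)"
  unfolding comb_def by (subst sum.swap) (simp add: cvec.scale_sum_left)

definition orthonormal_words :: "nat \<Rightarrow> ('n::finite list \<Rightarrow> 'h::complex_hilbert) \<Rightarrow> bool" where
  "orthonormal_words N e \<longleftrightarrow>
    (\<forall>\<alpha>\<in>words N. \<forall>\<beta>\<in>words N. cinner (e \<alpha>) (e \<beta>) = (if \<alpha> = \<beta> then 1 else 0))"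

lemma cinner_comb:
  assumes "orthonormal_words N e" "length \<gamma> < N"
  shows "cinner (comb e N g) (e \<gamma>) = g \<gamma>"
  unfolding comb_def
  by (rule orthonormal_expansion(1)) (use assms in \<open>auto simp: orthonormal_words_def\<close>)

lemma norm_comb:
  assumes "orthonormal_words N e"
  shows "(norm (comb e N g))\<^sup>2 = nsq N g"
  unfolding comb_def nsq_def
  by (rule orthonormal_expansion(2)) (use assms in \<open>auto simp: orthonormal_words_def\<close>)

text \<open>The creation operators of the full Fock space, compressed to the words of length at most \<open>M\<close>
  and scaled by \<open>t\<close>.\<close>

definition shift_tuple ::
    "('n::finite list \<Rightarrow> 'h) \<Rightarrow> nat \<Rightarrow> real \<Rightarrow> 'h::complex_hilbert op ^ 'n" where
  "shift_tuple e M t = (\<chi> i. Blinfun (\<lambda>x. \<Sum>\<alpha>\<in>words M. (complex_of_real t * cinner x (e \<alpha>)) *\<^sub>C e (i # \<alpha>)))"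

lemma shift_tuple_apply:
  "blinfun_apply (shift_tuple e M t $ i) x
    = (\<Sum>\<alpha>\<in>words M. (complex_of_real t * cinner x (e \<alpha>)) *\<^sub>C e (i # \<alpha>))"
  unfolding shift_tuple_def
  by (simp add: bounded_linear_Blinfun_apply bounded_linear_sum bounded_linear_rank_one)

lemma shift_tuple_sum:
  "(\<Sum>i\<in>UNIV. blinfun_apply (shift_tuple e M t $ i) (\<eta> i))
    = comb e (Suc M) (\<lambda>\<gamma>. case \<gamma> of [] \<Rightarrow> 0 | i # \<alpha> \<Rightarrow> complex_of_real t * cinner (\<eta> i) (e \<alpha>))"
  by (simp add: comb_def sum_words_Suc shift_tuple_apply)

text \<open>The factor t < 1 is forced by the open ball: for M > 0 the unscaled row has norm 1.
  Distinct pairs (i, \<alpha>) give distinct orthonormal targets, and Bessel's inequality absorbs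
  the components of \<eta> outside the span. The targets have length up to M, whence orthonormality
  for \<open>Suc M\<close>.\<close>

lemma shift_tuple_in_nc_ball:
  assumes e: "orthonormal_words (Suc M) e" and t: "0 \<le> t" "t < 1"
  shows "shift_tuple e M t \<in> nc_ball"
  unfolding nc_ball_iff
proof (intro conjI allI exI[of _ t])
  show "shift_tuple e M t $ i \<in> bounded_ops" for i
    unfolding bounded_ops_def mem_Collect_eq shift_tuple_apply cvec.scale_sum_right
    by (simp add: cinner_scaleC_left mult_ac)
  fix \<eta>
  have bessel: "(\<Sum>\<alpha>\<in>words M. (cmod (cinner v (e \<alpha>)))\<^sup>2) \<le> (norm v)\<^sup>2" for v
    by (rule orthonormal_expansion(3)) (use e in \<open>auto simp: orthonormal_words_def\<close>)
  have "(norm (\<Sum>i\<in>UNIV. blinfun_apply (shift_tuple e M t $ i) (\<eta> i)))\<^sup>2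
      = (\<Sum>i\<in>UNIV. \<Sum>\<alpha>\<in>words M. (cmod (complex_of_real t * cinner (\<eta> i) (e \<alpha>)))\<^sup>2)"
    unfolding shift_tuple_sum norm_comb[OF e] nsq_def sum_words_Suc by simp
  also have "\<dots> = t\<^sup>2 * (\<Sum>i\<in>UNIV. \<Sum>\<alpha>\<in>words M. (cmod (cinner (\<eta> i) (e \<alpha>)))\<^sup>2)"
    by (simp add: norm_mult power_mult_distrib sum_distrib_left)
  also have "\<dots> \<le> t\<^sup>2 * (\<Sum>i\<in>UNIV. (norm (\<eta> i))\<^sup>2)"
    by (intro mult_left_mono sum_mono bessel) simp
  also have "\<dots> = (t * sqrt (\<Sum>i\<in>UNIV. (norm (\<eta> i))\<^sup>2))\<^sup>2"
    by (simp add: power_mult_distrib sum_nonneg)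
  finally show "norm (\<Sum>i\<in>UNIV. blinfun_apply (shift_tuple e M t $ i) (\<eta> i))
      \<le> t * sqrt (\<Sum>i\<in>UNIV. (norm (\<eta> i))\<^sup>2)"
    by (rule power2_le_imp_le) (use t in \<open>simp_all add: sum_nonneg\<close>)
qed (use t in auto)

lemma shift_tuple_comb:
  assumes e: "orthonormal_words (Suc M) e"
  shows "blinfun_apply (shift_tuple e M t $ i) (comb e (Suc M) g)
    = comb e (Suc M) (\<lambda>\<gamma>. case \<gamma> of [] \<Rightarrow> 0 | j # \<delta> \<Rightarrow> if j = i then complex_of_real t * g \<delta> else 0)"
    (is "_ = comb e _ ?h")
proof -
  have "blinfun_apply (shift_tuple e M t $ i) (comb e (Suc M) g)
      = (\<Sum>\<alpha>\<in>words M. (complex_of_real t * g \<alpha>) *\<^sub>C e (i # \<alpha>))"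
    unfolding shift_tuple_apply
    by (intro sum.cong refl) (simp add: cinner_comb[OF e])
  \<comment> \<open>The fixed letter i is spread over all first letters j, so that
    \<open>sum_words_Suc\<close> can reassemble the right-hand side, whose [] term is 0.\<close>
  also have "\<dots> = (\<Sum>j\<in>UNIV. if j = i then \<Sum>\<alpha>\<in>words M. (complex_of_real t * g \<alpha>) *\<^sub>C e (j # \<alpha>) else 0)"
    by simp
  also have "\<dots> = (\<Sum>j\<in>UNIV. \<Sum>\<alpha>\<in>words M. ?h (j # \<alpha>) *\<^sub>C e (j # \<alpha>))"
    by (intro sum.cong refl) simp
  also have "\<dots> = comb e (Suc M) ?h"
    by (simp add: comb_def sum_words_Suc)
  finally show ?thesis .
qed

text \<open>Each letter prepends itself and contributes one factor t, so the coefficient at \<gamma>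
  comes from the word left after removing the prefix \<alpha>. Truncation causes no error, because
  prepending never shortens a word.\<close>

lemma word_op_shift_tuple_comb:
  assumes e: "orthonormal_words (Suc M) e"
  shows "blinfun_apply (word_op (shift_tuple e M t) \<alpha>) (comb e (Suc M) g)
    = comb e (Suc M) (\<lambda>\<gamma>. if take (length \<alpha>) \<gamma> = \<alpha>
        then complex_of_real t ^ length \<alpha> * g (drop (length \<alpha>) \<gamma>) else 0)"
proof (induction \<alpha>)
  case (Cons i \<alpha>)
  show ?case
    unfolding word_op.simps blinfun_compose.rep_eq o_apply Cons.IH shift_tuple_comb[OF e]
    by (rule comb_cong) (auto split: list.split)
qed simp

lemma homogeneous_part_apply:
  "blinfun_apply (homogeneous_part a k X) x
    = (\<Sum>\<alpha> | length \<alpha> = k. a \<alpha> *\<^sub>C blinfun_apply (word_op X \<alpha>) x)"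
  by (simp add: homogeneous_part_def blinfun.sum_left op_scaleC_apply)

lemma homogeneous_part_shift_tuple_comb:
  assumes e: "orthonormal_words (Suc M) e"
  shows "blinfun_apply (homogeneous_part p k (shift_tuple e M t)) (comb e (Suc M) g)
    = comb e (Suc M) (\<lambda>\<gamma>. if k \<le> length \<gamma>
        then complex_of_real t ^ k * p (take k \<gamma>) * g (drop k \<gamma>) else 0)"
  unfolding homogeneous_part_apply word_op_shift_tuple_comb[OF e] scaleC_comb sum_comb
proof (rule comb_cong)
  fix \<gamma> :: "'a list"
  have "(\<Sum>\<alpha> | length \<alpha> = k. p \<alpha> * (if take (length \<alpha>) \<gamma> = \<alpha>
        then complex_of_real t ^ length \<alpha> * g (drop (length \<alpha>) \<gamma>) else 0))
      = (\<Sum>\<alpha> | length \<alpha> = k. if take k \<gamma> = \<alpha> then p \<alpha> * (complex_of_real t ^ k * g (drop k \<gamma>)) else 0)"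
    by (intro sum.cong refl) auto
  also have "\<dots> = (if k \<le> length \<gamma> then complex_of_real t ^ k * p (take k \<gamma>) * g (drop k \<gamma>) else 0)"
    by (subst sum.delta') (auto simp: min_def)
  finally show "(\<Sum>\<alpha> | length \<alpha> = k. p \<alpha> * (if take (length \<alpha>) \<gamma> = \<alpha>
        then complex_of_real t ^ length \<alpha> * g (drop (length \<alpha>) \<gamma>) else 0))
      = (if k \<le> length \<gamma> then complex_of_real t ^ k * p (take k \<gamma>) * g (drop k \<gamma>) else 0)" .
qed

text \<open>The truncated shifts are jointly nilpotent, so the operator series stops after degree M
  and f acts on coordinates as left multiplication by its own series, dilated by t.\<close>

lemma has_free_series_shift_tuple:
  fixes f :: "'h::complex_hilbert op ^ 'n::finite \<Rightarrow> 'h op"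
  assumes f: "has_free_series f p" and e: "orthonormal_words (Suc M) e" and t: "0 \<le> t" "t < 1"
  shows "blinfun_apply (f (shift_tuple e M t)) (comb e (Suc M) g)
    = comb e (Suc M) (convolve (\<lambda>\<alpha>. complex_of_real t ^ length \<alpha> * p \<alpha>) g)"
proof -
  let ?X = "shift_tuple e M t" and ?x = "comb e (Suc M) g"
  let ?u = "\<lambda>k. blinfun_apply (homogeneous_part p k ?X) ?x"
  have "(\<lambda>k. homogeneous_part p k ?X) sums f ?X"
    using f shift_tuple_in_nc_ball[OF e t] unfolding has_free_series_def by blast
  then have "?u sums blinfun_apply (f ?X) ?x"
    by (rule bounded_linear.sums[OF blinfun.bounded_linear_left])
  moreover have "?u sums (\<Sum>k<Suc M. ?u k)"
  proof (rule sums_finite)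
    fix k assume "k \<notin> {..<Suc M}"
    then have "?u k = comb e (Suc M) (\<lambda>_. 0)"
      unfolding homogeneous_part_shift_tuple_comb[OF e] by (intro comb_cong) auto
    then show "?u k = 0" by (simp add: comb_def)
  qed simp
  ultimately have "blinfun_apply (f ?X) ?x = (\<Sum>k<Suc M. ?u k)"
    by (rule sums_unique2)
  also have "\<dots> = comb e (Suc M) (convolve (\<lambda>\<alpha>. complex_of_real t ^ length \<alpha> * p \<alpha>) g)"
    unfolding homogeneous_part_shift_tuple_comb[OF e] sum_comb
  proof (rule comb_cong)
    fix \<gamma> :: "'n list" assume "length \<gamma> < Suc M"
    then have "(\<Sum>k<Suc M. if k \<le> length \<gamma> then complex_of_real t ^ k * p (take k \<gamma>) * g (drop k \<gamma>) else 0)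
        = (\<Sum>k\<in>{..length \<gamma>}. if k \<le> length \<gamma> then complex_of_real t ^ k * p (take k \<gamma>) * g (drop k \<gamma>) else 0)"
      by (intro sum.mono_neutral_right) auto
    also have "\<dots> = convolve (\<lambda>\<alpha>. complex_of_real t ^ length \<alpha> * p \<alpha>) g \<gamma>"
      unfolding convolve_def by (intro sum.cong refl) (simp add: min_def)
    finally show "(\<Sum>k<Suc M. if k \<le> length \<gamma> then complex_of_real t ^ k * p (take k \<gamma>) * g (drop k \<gamma>) else 0)
        = convolve (\<lambda>\<alpha>. complex_of_real t ^ length \<alpha> * p \<alpha>) g \<gamma>" .
  qed
  finally show ?thesis .
qed

lemma exists_orthonormal_words:
  assumes "infinite_dimensional TYPE('h::complex_hilbert)"
  obtains e :: "'n::finite list \<Rightarrow> 'h::complex_hilbert" where "orthonormal_words N e"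
  using exists_orthonormal[OF assms finite_words[of N]] that unfolding orthonormal_words_def by blast

text \<open>Applied to the vacuum vector, the value of f at the shifts with t = 1/2 has coordinate a
  \<gamma> / 2^|\<gamma>| at \<gamma>; truncation at the length of \<gamma> is just enough to see
  it. This makes the definite description \<open>free_coeff\<close> usable.\<close>

lemma has_free_series_unique:
  fixes f :: "'h::complex_hilbert op ^ 'n::finite \<Rightarrow> 'h op"
  assumes inf: "infinite_dimensional TYPE('h)" and a: "has_free_series f a" and b: "has_free_series f b"
  shows "a = b"
proof
  fix \<gamma> :: "'n list"
  obtain e :: "'n list \<Rightarrow> 'h" where e: "orthonormal_words (Suc (length \<gamma>)) e"
    using exists_orthonormal_words[OF inf] .
  have "(1/2) ^ length \<gamma> * a' \<gamma> = cinner (blinfun_apply (f (shift_tuple e (length \<gamma>) (1/2)))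
      (comb e (Suc (length \<gamma>)) unit_series)) (e \<gamma>)" if "has_free_series f a'" for a'
    using has_free_series_shift_tuple[OF that e, of "1/2" unit_series] by (simp add: cinner_comb[OF e])
  from trans[OF this[OF a] this[OF b, symmetric]] show "a \<gamma> = b \<gamma>" by simp
qed

lemma free_coeff_eq:
  fixes f :: "'h::complex_hilbert op ^ 'n::finite \<Rightarrow> 'h op"
  assumes "infinite_dimensional TYPE('h)" and "has_free_series f a"
  shows "free_coeff f = a"
  unfolding free_coeff_def using assms has_free_series_unique by blast

text \<open>This says that the row of left multiplications by the p i is a contraction. It uses the
  same N on both sides, so it makes sense for arbitrary coefficient families \<eta>.\<close>

definition row_contractive :: "('n::finite \<Rightarrow> 'n list \<Rightarrow> complex) \<Rightarrow> bool" where
  "row_contractive p \<longleftrightarrow>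
    (\<forall>N \<eta>. nsq N (\<lambda>\<gamma>. \<Sum>i\<in>UNIV. convolve (p i) (\<eta> i) \<gamma>) \<le> (\<Sum>i\<in>UNIV. nsq N (\<eta> i)))"

lemma self_map_row_contractive:
  fixes \<phi> :: "'h::complex_hilbert op ^ 'n::finite \<Rightarrow> 'h op ^ 'n"
  assumes inf: "infinite_dimensional TYPE('h)"
    and p: "\<And>i. has_free_series (\<lambda>X. \<phi> X $ i) (p i)" and \<phi>: "\<phi> ` nc_ball \<subseteq> nc_ball"
  shows "row_contractive p"
  unfolding row_contractive_def
proof (intro allI)
  fix N and \<eta> :: "'n \<Rightarrow> 'n list \<Rightarrow> complex"
  show "nsq N (\<lambda>\<gamma>. \<Sum>i\<in>UNIV. convolve (p i) (\<eta> i) \<gamma>) \<le> (\<Sum>i\<in>UNIV. nsq N (\<eta> i))"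
  proof (cases N)
    case (Suc M)
    obtain e :: "'n list \<Rightarrow> 'h" where e: "orthonormal_words (Suc M) e"
      using exists_orthonormal_words[OF inf] .
    \<comment> \<open>F t belongs to \<phi> dilated by t. For t < 1 the shifts lie in the ball,
      hence so does their image under \<phi>, and this bounds F t. Since F is continuous in t, the
      limit t \<rightarrow> 1 gives the claim, which concerns F 1.\<close>
    define F where "F t = nsq N (\<lambda>\<gamma>. \<Sum>i\<in>UNIV. convolve (\<lambda>\<alpha>. complex_of_real t ^ length \<alpha> * p i \<alpha>) (\<eta> i) \<gamma>)" for t
    have bound: "F t \<le> (\<Sum>i\<in>UNIV. nsq N (\<eta> i))" if t: "0 < t" "t < 1" for t
    proof -
      have t0: "0 \<le> t" using t by simp
      define X where "X = shift_tuple e M t"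
      have "\<phi> X \<in> nc_ball" using \<phi> shift_tuple_in_nc_ball[OF e t0 t(2)] by (auto simp: X_def)
      then obtain \<rho> where \<rho>: "\<rho> \<ge> 0" "\<rho> < 1" "\<And>\<eta>. norm (\<Sum>i\<in>UNIV. blinfun_apply (\<phi> X $ i) (\<eta> i))
          \<le> \<rho> * sqrt (\<Sum>i\<in>UNIV. (norm (\<eta> i))\<^sup>2)"
        unfolding nc_ball_iff by blast
      have "F t = (norm (comb e (Suc M) (\<lambda>\<gamma>. \<Sum>i\<in>UNIV. convolve (\<lambda>\<alpha>. complex_of_real t ^ length \<alpha> * p i \<alpha>) (\<eta> i) \<gamma>)))\<^sup>2"
        unfolding F_def norm_comb[OF e] Suc ..
      also have "\<dots> = (norm (\<Sum>i\<in>UNIV. blinfun_apply (\<phi> X $ i) (comb e (Suc M) (\<eta> i))))\<^sup>2"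
        unfolding X_def by (simp only: has_free_series_shift_tuple[OF p e t0 t(2)] sum_comb)
      also have "\<dots> \<le> (\<rho> * sqrt (\<Sum>i\<in>UNIV. (norm (comb e (Suc M) (\<eta> i)))\<^sup>2))\<^sup>2"
        by (intro power_mono \<rho>) simp
      also have "\<dots> = \<rho>\<^sup>2 * (\<Sum>i\<in>UNIV. nsq N (\<eta> i))"
        by (simp add: power_mult_distrib sum_nonneg norm_comb[OF e] Suc nsq_def)
      also have "\<dots> \<le> 1 * (\<Sum>i\<in>UNIV. nsq N (\<eta> i))"
        using \<rho> by (intro mult_right_mono) (auto simp: abs_square_le_1 sum_nonneg nsq_def)
      finally show ?thesis by simp
    qed
    have "(F \<longlongrightarrow> F 1) (at_left 1)"
      unfolding F_def nsq_def convolve_def by (intro tendsto_intros)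
    moreover have "eventually (\<lambda>t. F t \<le> (\<Sum>i\<in>UNIV. nsq N (\<eta> i))) (at_left 1)"
      using bound by (auto simp: eventually_at_left_field intro!: exI[of _ 0])
    ultimately have "F 1 \<le> (\<Sum>i\<in>UNIV. nsq N (\<eta> i))"
      by (intro tendsto_upperbound) auto
    then show ?thesis by (simp add: F_def)
  qed (simp add: nsq_def)
qed

section \<open>Substitution into formal power series\<close>

lemma convolve_lincomb:
  "convolve p (\<lambda>\<gamma>. a * f \<gamma> + b * g \<gamma>) \<gamma> = a * convolve p f \<gamma> + b * convolve p g \<gamma>"
  by (simp add: convolve_def sum.distrib sum_distrib_left algebra_simps)

lemma convolve_zero [simp]: "convolve p (\<lambda>_. 0) \<gamma> = 0"
  by (simp add: convolve_def)

lemma convolve_Nil [simp]: "convolve p g [] = p [] * g []"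
  by (simp add: convolve_def)

lemma nsq_nonneg [simp]: "0 \<le> nsq N g"
  by (simp add: nsq_def sum_nonneg)

lemma nsq_zero [simp]: "nsq N (\<lambda>_. 0) = 0"
  by (simp add: nsq_def)

lemma nsq_0 [simp]: "nsq 0 g = 0"
  by (simp add: nsq_def)

lemma nsq_Suc: "nsq (Suc N) g = (cmod (g []))\<^sup>2 + (\<Sum>i\<in>UNIV. nsq N (\<lambda>\<alpha>. g (i # \<alpha>)))"
  by (simp add: nsq_def sum_words_Suc)

lemma nsq_scale: "nsq N (\<lambda>\<alpha>. c * g \<alpha>) = (cmod c)\<^sup>2 * nsq N g"
  by (simp add: nsq_def norm_mult power_mult_distrib sum_distrib_left)

lemma nsq_mono: "M \<le> N \<Longrightarrow> nsq M g \<le> nsq N g"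
  unfolding nsq_def by (intro sum_mono2) auto

lemma sqrt_nsq_triangle:
  "sqrt (nsq N (\<lambda>\<alpha>. f \<alpha> + g \<alpha>)) \<le> sqrt (nsq N f) + sqrt (nsq N g)"
proof -
  have "L2_set (\<lambda>\<alpha>. cmod (f \<alpha> + g \<alpha>)) (words N) \<le> L2_set (\<lambda>\<alpha>. cmod (f \<alpha>) + cmod (g \<alpha>)) (words N)"
    by (intro L2_set_mono norm_triangle_ineq) auto
  also have "\<dots> \<le> L2_set (\<lambda>\<alpha>. cmod (f \<alpha>)) (words N) + L2_set (\<lambda>\<alpha>. cmod (g \<alpha>)) (words N)"
    by (rule L2_set_triangle_ineq)
  finally show ?thesis by (simp add: L2_set_def nsq_def)
qed

lemma nsq_add_unit:
  "nsq (Suc N) (\<lambda>\<gamma>. h \<gamma> + c * unit_series \<gamma>) = nsq (Suc N) h + (cmod c)\<^sup>2 + 2 * Re (cnj c * h [])"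
proof -
  have "(cmod (h [] + c))\<^sup>2 = (cmod (h []))\<^sup>2 + (cmod c)\<^sup>2 + 2 * Re (cnj c * h [])"
    unfolding cmod_power2 by (simp add: power2_eq_square algebra_simps)
  then show ?thesis by (simp add: nsq_Suc unit_series_def)
qed

text \<open>The product f \<ell> with the linear form \<ell> = \<Sum> conj z_i X_i. The factor
  stands on the right because substitution peels letters off on the left, so the two operations
  hardly interfere.\<close>

definition mult_linear_form :: "('n \<Rightarrow> complex) \<Rightarrow> ('n list \<Rightarrow> complex) \<Rightarrow> 'n list \<Rightarrow> complex" where
  "mult_linear_form z f \<gamma> = (if \<gamma> = [] then 0 else f (butlast \<gamma>) * cnj (z (last \<gamma>)))"

lemma mult_linear_form_Nil [simp]: "mult_linear_form z f [] = 0"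
  by (simp add: mult_linear_form_def)

text \<open>For f = f [] + \<Sum> X_i f_i, right multiplication by \<ell> passes to the tails f_i,
  and only the constant term adds something new, namely f [] \<ell>. This recursion drives the
  induction in \<open>subst_defect\<close>.\<close>

lemma mult_linear_form_Cons:
  "mult_linear_form z f (i # \<alpha>) = mult_linear_form z (\<lambda>\<beta>. f (i # \<beta>)) \<alpha> + f [] * cnj (z i) * unit_series \<alpha>"
  by (simp add: mult_linear_form_def unit_series_def)

text \<open>Every nonempty word splits uniquely into a word and its last letter, so no terms merge
  and the norm is multiplied exactly. The degree rises by one, whence \<open>Suc d\<close>.\<close>

lemma nsq_mult_linear_form:
  "nsq (Suc d) (mult_linear_form z f) = (\<Sum>i\<in>UNIV. (cmod (z i))\<^sup>2) * nsq d (f :: 'n::finite list \<Rightarrow> complex)"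
proof -
  have "(\<Sum>i\<in>UNIV. (cmod (z i))\<^sup>2) * nsq d f = (\<Sum>(i, \<alpha>)\<in>UNIV \<times> words d. (cmod (z i))\<^sup>2 * (cmod (f \<alpha>))\<^sup>2)"
    by (simp add: nsq_def sum_product sum.cartesian_product)
  also have "\<dots> = (\<Sum>\<gamma>\<in>words (Suc d) - {[]}. (cmod (mult_linear_form z f \<gamma>))\<^sup>2)"
    by (rule sum.reindex_bij_witness[where j = "\<lambda>(i, \<alpha>). \<alpha> @ [i]" and i = "\<lambda>\<gamma>. (last \<gamma>, butlast \<gamma>)"])
      (auto simp: mult_linear_form_def norm_mult power_mult_distrib less_diff_conv2 Suc_le_eq)
  also have "\<dots> = nsq (Suc d) (mult_linear_form z f)"
    unfolding nsq_def by (subst (2) sum.remove[of _ "[]"]) simp_all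
  finally show ?thesis ..
qed

text \<open>Horner's scheme for composing p with the part of f of degree below d: f = f [] + \<Sum>
  X_i f_i becomes f [] + \<Sum> p_i (f_i \<circ> p). The row of multiplications by the p i stands
  outermost at every stage, where contractivity applies.\<close>

primrec subst_series ::
    "('n::finite \<Rightarrow> 'n list \<Rightarrow> complex) \<Rightarrow> nat \<Rightarrow> ('n list \<Rightarrow> complex) \<Rightarrow> 'n list \<Rightarrow> complex" where
  "subst_series p 0 f = (\<lambda>\<gamma>. 0)"
| "subst_series p (Suc d) f = (\<lambda>\<gamma>. f [] * unit_series \<gamma>
     + (\<Sum>i\<in>UNIV. convolve (p i) (subst_series p d (\<lambda>\<alpha>. f (i # \<alpha>))) \<gamma>))"

lemma subst_series_lincomb:
  "subst_series p d (\<lambda>\<alpha>. a * f \<alpha> + b * g \<alpha>) = (\<lambda>\<gamma>. a * subst_series p d f \<gamma> + b * subst_series p d g \<gamma>)"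
proof (induction d arbitrary: f g)
  case (Suc d)
  show ?case
    by (simp add: Suc.IH convolve_lincomb sum.distrib sum_distrib_left algebra_simps)
qed simp

lemma subst_series_diff:
  "subst_series p d (\<lambda>\<alpha>. f \<alpha> - g \<alpha>) = (\<lambda>\<gamma>. subst_series p d f \<gamma> - subst_series p d g \<gamma>)"
  using subst_series_lincomb[of p d 1 f "-1" g] by simp

lemma subst_series_add:
  "subst_series p d (\<lambda>\<alpha>. f \<alpha> + g \<alpha>) = (\<lambda>\<gamma>. subst_series p d f \<gamma> + subst_series p d g \<gamma>)"
  using subst_series_lincomb[of p d 1 f 1 g] by simp

lemma subst_series_scale:
  "subst_series p d (\<lambda>\<alpha>. a * f \<alpha>) = (\<lambda>\<gamma>. a * subst_series p d f \<gamma>)"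
  using subst_series_lincomb[of p d a f 0 f] by simp

lemma subst_series_zero [simp]: "subst_series p d (\<lambda>\<alpha>. 0) = (\<lambda>\<gamma>. 0)"
  using subst_series_scale[of p d 0] by simp

lemma subst_series_unit: "subst_series p (Suc d) unit_series = unit_series"
  by (auto simp: unit_series_def fun_eq_iff)

lemma subst_series_cong:
  "(\<And>\<alpha>. length \<alpha> < d \<Longrightarrow> f \<alpha> = g \<alpha>) \<Longrightarrow> subst_series p d f = subst_series p d g"
proof (induction d arbitrary: f g)
  case (Suc d)
  have "subst_series p d (\<lambda>\<alpha>. f (i # \<alpha>)) = subst_series p d (\<lambda>\<alpha>. g (i # \<alpha>))" for i
    by (rule Suc.IH) (simp add: Suc.prems)
  with Suc.prems[of "[]"] show ?case by simp
qed simp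

lemma subst_series_Suc_supported:
  "(\<And>\<alpha>. d \<le> length \<alpha> \<Longrightarrow> f \<alpha> = 0) \<Longrightarrow> subst_series p (Suc d) f = subst_series p d f"
proof (induction d arbitrary: f)
  case (Suc d)
  have IH: "subst_series p (Suc d) (\<lambda>\<alpha>. f (i # \<alpha>)) = subst_series p d (\<lambda>\<alpha>. f (i # \<alpha>))" for i
    by (rule Suc.IH) (simp add: Suc.prems)
  show ?case
    by (subst (1 2) subst_series.simps(2)) (simp only: IH)
qed simp

lemma subst_series_supported:
  assumes "d \<le> e" "\<And>\<alpha>. d \<le> length \<alpha> \<Longrightarrow> f \<alpha> = 0"
  shows "subst_series p e f = subst_series p d f"
  using assms(1)
proof (induction rule: dec_induct)
  case (step n)
  then show ?case using subst_series_Suc_supported[of n f p] assms(2) by simp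
qed simp

section \<open>Norm estimates for substitution into a row contraction\<close>

locale row_contraction =
  fixes p :: "'n::finite \<Rightarrow> 'n list \<Rightarrow> complex" and r :: real
  assumes contractive: "row_contractive p"
    and r_def: "r = sqrt (\<Sum>i\<in>UNIV. (cmod (p i []))\<^sup>2)" and r_less: "r < 1"
begin

lemma r_nonneg: "0 \<le> r"
  by (simp add: r_def sum_nonneg)

lemma r_sq: "r\<^sup>2 = (\<Sum>i\<in>UNIV. (cmod (p i []))\<^sup>2)"
  by (simp add: r_def sum_nonneg)

lemma r_sq_less: "r\<^sup>2 < 1"
  using r_nonneg r_less by (simp add: abs_square_less_1)

lemma contraction: "nsq N (\<lambda>\<gamma>. \<Sum>i\<in>UNIV. convolve (p i) (\<eta> i) \<gamma>) \<le> (\<Sum>i\<in>UNIV. nsq N (\<eta> i))"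
  using contractive unfolding row_contractive_def by blast

abbreviation mult_zero_form :: "('n list \<Rightarrow> complex) \<Rightarrow> 'n list \<Rightarrow> complex" where
  "mult_zero_form \<equiv> mult_linear_form (\<lambda>i. p i [])"

text \<open>With \<open>M\<close> the row of left multiplications by the series \<open>p i\<close> and \<open>v\<close> the constant series \<open>1\<close>,
  this is the inequality \<open>\<parallel>c \<Delta> v + M \<xi>\<parallel>\<^sup>2 \<le> |c|\<^sup>2 \<langle>\<Delta> v, v\<rangle> + \<parallel>\<xi>\<parallel>\<^sup>2\<close> for the defect \<open>\<Delta> = 1 - M M\<^sup>*\<close>.\<close>

lemma defect_inequality:
  "nsq (Suc N) (\<lambda>\<gamma>. c * unit_series \<gamma> + (\<Sum>i\<in>UNIV. convolve (p i) (\<lambda>\<beta>. \<xi> i \<beta> - c * cnj (p i []) * unit_series \<beta>) \<gamma>))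
    \<le> (cmod c)\<^sup>2 * (1 - r\<^sup>2) + (\<Sum>i\<in>UNIV. nsq (Suc N) (\<xi> i))"
proof -
  \<comment> \<open>This is \<eta> = \<xi> - c M* v, chosen so that c v + M \<eta> = c \<Delta> v +
    M \<xi>. Expanding |\<xi>|^2 and |c v + M \<eta>|^2 gives the same cross term 2 Re (conj c h
    []), and what remains is |M \<eta>| \<le> |\<eta>|.\<close>
  define \<eta> where "\<eta> i \<beta> = \<xi> i \<beta> - c * cnj (p i []) * unit_series \<beta>" for i \<beta>
  define h where "h \<gamma> = (\<Sum>i\<in>UNIV. convolve (p i) (\<eta> i) \<gamma>)" for \<gamma>
  have h0: "h [] = (\<Sum>i\<in>UNIV. p i [] * \<eta> i [])"
    by (simp add: h_def)
  have \<xi>: "nsq (Suc N) (\<xi> i) = nsq (Suc N) (\<eta> i) + (cmod c)\<^sup>2 * (cmod (p i []))\<^sup>2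
      + 2 * Re (cnj c * (p i [] * \<eta> i []))" for i
  proof -
    have "\<xi> i = (\<lambda>\<gamma>. \<eta> i \<gamma> + (c * cnj (p i [])) * unit_series \<gamma>)"
      by (simp add: \<eta>_def)
    then show ?thesis
      using nsq_add_unit[of N "\<eta> i" "c * cnj (p i [])"] by (simp add: norm_mult power_mult_distrib mult.assoc)
  qed
  have "(\<Sum>i\<in>UNIV. nsq (Suc N) (\<xi> i)) = (\<Sum>i\<in>UNIV. nsq (Suc N) (\<eta> i)) + (cmod c)\<^sup>2 * r\<^sup>2 + 2 * Re (cnj c * h [])"
    unfolding \<xi> h0 r_sq sum.distrib by (simp add: sum_distrib_left Re_sum)
  moreover have "nsq (Suc N) (\<lambda>\<gamma>. h \<gamma> + c * unit_series \<gamma>)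
      \<le> (\<Sum>i\<in>UNIV. nsq (Suc N) (\<eta> i)) + (cmod c)\<^sup>2 + 2 * Re (cnj c * h [])"
    unfolding nsq_add_unit h_def using contraction[of "Suc N" \<eta>] by simp
  ultimately show ?thesis
    unfolding h_def \<eta>_def by (simp add: algebra_simps)
qed

text \<open>With g = c + \<Sum> X_i g_i, the tails of g (1 - \<ell>) are g_i (1 - \<ell>) - c conj
  z_i for z_i = p i [], so substitution produces exactly the left side of
  \<open>defect_inequality\<close>, with \<xi>_i the composition obtained from g_i. The support
  condition guarantees that the cut at \<open>Suc d\<close> loses nothing of g \<ell>.\<close>

lemma subst_defect:
  assumes "\<And>\<alpha>. d \<le> length \<alpha> \<Longrightarrow> g \<alpha> = 0"
  shows "nsq N (subst_series p (Suc d) (\<lambda>\<alpha>. g \<alpha> - mult_zero_form g \<alpha>)) \<le> (1 - r\<^sup>2) * nsq d g"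
proof -
  have "nsq (Suc N) (subst_series p (Suc d) (\<lambda>\<alpha>. g \<alpha> - mult_zero_form g \<alpha>)) \<le> (1 - r\<^sup>2) * nsq d g"
    using assms
  proof (induction d arbitrary: g)
    case 0
    then have "g = (\<lambda>_. 0)" by auto
    then have "(\<lambda>\<alpha>. g \<alpha> - mult_zero_form g \<alpha>) = (\<lambda>_. 0)" by (auto simp: mult_linear_form_def)
    then show ?case by (simp only: subst_series_zero nsq_zero) simp
  next
    case (Suc d)
    define g' where "g' i \<alpha> = g (i # \<alpha>)" for i \<alpha>
    define \<xi> where "\<xi> i = subst_series p (Suc d) (\<lambda>\<alpha>. g' i \<alpha> - mult_zero_form (g' i) \<alpha>)" for i
    define c where "c = g []"
    have IH: "nsq (Suc N) (\<xi> i) \<le> (1 - r\<^sup>2) * nsq d (g' i)" for i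
      unfolding \<xi>_def by (rule Suc.IH) (simp add: g'_def Suc.prems)
    have tail: "subst_series p (Suc d) (\<lambda>\<alpha>. g (i # \<alpha>) - mult_zero_form g (i # \<alpha>))
        = (\<lambda>\<beta>. \<xi> i \<beta> - c * cnj (p i []) * unit_series \<beta>)" for i
    proof -
      have "(\<lambda>\<alpha>. g (i # \<alpha>) - mult_zero_form g (i # \<alpha>))
          = (\<lambda>\<alpha>. (g' i \<alpha> - mult_zero_form (g' i) \<alpha>) - c * cnj (p i []) * unit_series \<alpha>)"
        by (simp add: fun_eq_iff mult_linear_form_Cons g'_def[abs_def] c_def)
      then show ?thesis
        by (simp only: subst_series_diff[of p "Suc d" "\<lambda>\<alpha>. g' i \<alpha> - mult_zero_form (g' i) \<alpha>"]
            subst_series_scale subst_series_unit \<xi>_def)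
    qed
    have "subst_series p (Suc (Suc d)) (\<lambda>\<alpha>. g \<alpha> - mult_zero_form g \<alpha>)
        = (\<lambda>\<gamma>. c * unit_series \<gamma> + (\<Sum>i\<in>UNIV. convolve (p i) (\<lambda>\<beta>. \<xi> i \<beta> - c * cnj (p i []) * unit_series \<beta>) \<gamma>))"
      by (subst subst_series.simps(2)) (simp only: tail, simp add: c_def)
    then have "nsq (Suc N) (subst_series p (Suc (Suc d)) (\<lambda>\<alpha>. g \<alpha> - mult_zero_form g \<alpha>))
        \<le> (cmod c)\<^sup>2 * (1 - r\<^sup>2) + (\<Sum>i\<in>UNIV. nsq (Suc N) (\<xi> i))"
      using defect_inequality by simp
    also have "\<dots> \<le> (cmod c)\<^sup>2 * (1 - r\<^sup>2) + (\<Sum>i\<in>UNIV. (1 - r\<^sup>2) * nsq d (g' i))"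
      by (intro add_left_mono sum_mono IH)
    also have "\<dots> = (1 - r\<^sup>2) * nsq (Suc d) g"
      by (simp add: nsq_Suc c_def g'_def[abs_def] sum_distrib_left algebra_simps)
    finally show ?case .
  qed
  then show ?thesis
    using nsq_mono[of N "Suc N"] by (meson le_SucI order.refl order.trans)
qed

lemma nsq_unit: "sqrt (nsq N (\<lambda>\<gamma>. c * unit_series \<gamma>)) \<le> cmod c"
  by (cases N) (simp_all add: nsq_scale nsq_Suc unit_series_def real_sqrt_mult)

text \<open>The triangle inequality costs one copy of the norm of f per Horner step, hence the
  factor d. The bound serves only for the remainder in \<open>subst_iterate\<close>, where it comes
  with r^K.\<close>

lemma subst_crude: "sqrt (nsq N (subst_series p d f)) \<le> real d * sqrt (nsq d f)"
proof (induction d arbitrary: f)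
  case (Suc d)
  define h where "h i = subst_series p d (\<lambda>\<alpha>. f (i # \<alpha>))" for i
  have tail: "(\<Sum>i\<in>UNIV. nsq d (\<lambda>\<alpha>. f (i # \<alpha>))) \<le> nsq (Suc d) f" and head: "(cmod (f []))\<^sup>2 \<le> nsq (Suc d) f"
    by (simp_all add: nsq_Suc sum_nonneg)
  have hi: "nsq N (h i) \<le> (real d)\<^sup>2 * nsq d (\<lambda>\<alpha>. f (i # \<alpha>))" for i
    using power_mono[OF Suc.IH[of "\<lambda>\<alpha>. f (i # \<alpha>)"], of 2] by (simp add: h_def power_mult_distrib)
  have "nsq N (\<lambda>\<gamma>. \<Sum>i\<in>UNIV. convolve (p i) (h i) \<gamma>) \<le> (\<Sum>i\<in>UNIV. nsq N (h i))"
    by (rule contraction)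
  also have "\<dots> \<le> (\<Sum>i\<in>UNIV. (real d)\<^sup>2 * nsq d (\<lambda>\<alpha>. f (i # \<alpha>)))"
    by (intro sum_mono hi)
  also have "\<dots> \<le> (real d)\<^sup>2 * nsq (Suc d) f"
    unfolding sum_distrib_left[symmetric] by (intro mult_left_mono tail) simp
  finally have "sqrt (nsq N (\<lambda>\<gamma>. \<Sum>i\<in>UNIV. convolve (p i) (h i) \<gamma>)) \<le> real d * sqrt (nsq (Suc d) f)"
    by (metis real_sqrt_abs real_sqrt_le_iff real_sqrt_mult abs_of_nat)
  moreover have "sqrt (nsq N (\<lambda>\<gamma>. f [] * unit_series \<gamma>)) \<le> sqrt (nsq (Suc d) f)"
    by (rule order.trans[OF nsq_unit real_le_rsqrt[OF head]])
  ultimately have "sqrt (nsq N (\<lambda>\<gamma>. f [] * unit_series \<gamma>)) + sqrt (nsq N (\<lambda>\<gamma>. \<Sum>i\<in>UNIV. convolve (p i) (h i) \<gamma>))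
      \<le> sqrt (nsq (Suc d) f) + real d * sqrt (nsq (Suc d) f)"
    by (intro add_mono)
  also have "\<dots> = real (Suc d) * sqrt (nsq (Suc d) f)"
    by (simp add: distrib_right)
  finally have "sqrt (nsq N (\<lambda>\<gamma>. f [] * unit_series \<gamma>)) + sqrt (nsq N (\<lambda>\<gamma>. \<Sum>i\<in>UNIV. convolve (p i) (h i) \<gamma>))
      \<le> real (Suc d) * sqrt (nsq (Suc d) f)" .
  then show ?case
    unfolding subst_series.simps h_def by (rule order.trans[OF sqrt_nsq_triangle])
qed simp

lemma sqrt_nsq_mult_zero_form: "sqrt (nsq (Suc d) (mult_zero_form f)) = r * sqrt (nsq d f)"
  unfolding nsq_mult_linear_form r_sq[symmetric] by (simp add: real_sqrt_mult r_nonneg)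

text \<open>Writing \<open>f = (f - f \<ell>) + f \<ell>\<close> with the linear form \<open>\<ell> = \<Sum>i. cnj (p i []) X\<^sub>i\<close> and iterating; the
  remainder is controlled by the crude bound.\<close>

lemma subst_iterate:
  assumes "\<And>\<alpha>. d \<le> length \<alpha> \<Longrightarrow> f \<alpha> = 0"
  shows "sqrt (nsq N (subst_series p d f))
    \<le> sqrt (1 - r\<^sup>2) * (\<Sum>m<K. r ^ m) * sqrt (nsq d f) + real (d + K) * r ^ K * sqrt (nsq d f)"
  using assms
proof (induction K arbitrary: d f)
  case 0
  then show ?case using subst_crude[of N d f] by simp
next
  case (Suc K)
  have supp: "mult_zero_form f \<alpha> = 0" if "Suc d \<le> length \<alpha>" for \<alpha>
    using that Suc.prems[of "butlast \<alpha>"] by (auto simp: mult_linear_form_def)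
  have "subst_series p d f = subst_series p (Suc d) (\<lambda>\<alpha>. (f \<alpha> - mult_zero_form f \<alpha>) + mult_zero_form f \<alpha>)"
    using subst_series_Suc_supported[of d f p] Suc.prems by simp
  also have "\<dots> = (\<lambda>\<gamma>. subst_series p (Suc d) (\<lambda>\<alpha>. f \<alpha> - mult_zero_form f \<alpha>) \<gamma>
      + subst_series p (Suc d) (mult_zero_form f) \<gamma>)"
    by (rule subst_series_add)
  finally have "sqrt (nsq N (subst_series p d f)) \<le> sqrt (nsq N (subst_series p (Suc d) (\<lambda>\<alpha>. f \<alpha> - mult_zero_form f \<alpha>)))
      + sqrt (nsq N (subst_series p (Suc d) (mult_zero_form f)))"
    by (simp only: sqrt_nsq_triangle)
  also have "sqrt (nsq N (subst_series p (Suc d) (\<lambda>\<alpha>. f \<alpha> - mult_zero_form f \<alpha>))) \<le> sqrt (1 - r\<^sup>2) * sqrt (nsq d f)"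
    unfolding real_sqrt_mult[symmetric] real_sqrt_le_iff by (rule subst_defect[OF Suc.prems])
  \<comment> \<open>Multiplication by \<ell> raises the degree bound by one and scales the norm by
    r. Hence d is arbitrary in the induction, and the remainder carries d + K and r^K.\<close>
  also have "sqrt (nsq N (subst_series p (Suc d) (mult_zero_form f)))
      \<le> sqrt (1 - r\<^sup>2) * (\<Sum>m<K. r ^ m) * (r * sqrt (nsq d f)) + real (Suc d + K) * r ^ K * (r * sqrt (nsq d f))"
    using Suc.IH[of "Suc d" "mult_zero_form f"] supp unfolding sqrt_nsq_mult_zero_form by blast
  also have "sqrt (1 - r\<^sup>2) * sqrt (nsq d f) + \<dots> = sqrt (1 - r\<^sup>2) * (\<Sum>m<Suc K. r ^ m) * sqrt (nsq d f)
      + real (d + Suc K) * r ^ Suc K * sqrt (nsq d f)"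
    unfolding sum.lessThan_Suc_shift by (simp add: sum_distrib_left sum_distrib_right algebra_simps)
  finally show ?case by simp
qed

text \<open>As K \<rightarrow> \<infinity> in \<open>subst_iterate\<close>, the geometric sum tends
  to 1 / (1 - r) and the remainder to 0, because K r^K does. The square of sqrt (1 - r^2) / (1 - r)
  is (1 + r) / (1 - r).\<close>

lemma nsq_subst_series:
  "nsq N (subst_series p d f) \<le> (1 + r) / (1 - r) * nsq d f"
proof -
  \<comment> \<open>Both sides see only words of length below d, so f may be cut off there to meet
    the support condition of \<open>subst_iterate\<close>.\<close>
  define f' where "f' \<alpha> = (if length \<alpha> < d then f \<alpha> else 0)" for \<alpha>
  have f': "nsq d f' = nsq d f" "subst_series p d f' = subst_series p d f"
    by (auto simp: nsq_def f'_def intro!: subst_series_cong)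
  have lim: "(\<lambda>K. sqrt (1 - r\<^sup>2) * (\<Sum>m<K. r ^ m) * sqrt (nsq d f) + real (d + K) * r ^ K * sqrt (nsq d f))
      \<longlonglongrightarrow> sqrt (1 - r\<^sup>2) * (1 / (1 - r)) * sqrt (nsq d f) + 0 * sqrt (nsq d f)"
  proof (intro tendsto_intros)
    show "(\<lambda>K. \<Sum>m<K. r ^ m) \<longlonglongrightarrow> 1 / (1 - r)"
      using geometric_sums[of r] r_nonneg r_less by (simp add: sums_def)
    have "(\<lambda>K. real d * r ^ K + real K * r ^ K) \<longlonglongrightarrow> real d * 0 + 0"
      using r_nonneg r_less
      by (intro tendsto_intros LIMSEQ_power_zero powser_times_n_limit_0) auto
    then show "(\<lambda>K. real (d + K) * r ^ K) \<longlonglongrightarrow> 0"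
      by (simp add: algebra_simps)
  qed
  have "sqrt (nsq N (subst_series p d f)) \<le> sqrt (1 - r\<^sup>2) * (1 / (1 - r)) * sqrt (nsq d f)"
  proof -
    have "sqrt (nsq N (subst_series p d f)) \<le> sqrt (1 - r\<^sup>2) * (\<Sum>m<K. r ^ m) * sqrt (nsq d f)
        + real (d + K) * r ^ K * sqrt (nsq d f)" for K
      using subst_iterate[of d f' N K] by (simp add: f'(1) f'(2)) (simp add: f'_def)
    then show ?thesis
      using LIMSEQ_le_const[OF lim] by simp
  qed
  then have "(sqrt (nsq N (subst_series p d f)))\<^sup>2 \<le> (sqrt (1 - r\<^sup>2) * (1 / (1 - r)) * sqrt (nsq d f))\<^sup>2"
    by (intro power_mono) auto
  then have "nsq N (subst_series p d f) \<le> (1 - r\<^sup>2) * (1 / (1 - r))\<^sup>2 * nsq d f"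
    using r_sq_less unfolding power_mult_distrib by simp
  also have "(1 - r\<^sup>2) * (1 / (1 - r))\<^sup>2 = (1 + r) / (1 - r)"
    using r_less by (simp add: power2_eq_square divide_simps) (simp add: algebra_simps)
  finally show ?thesis .
qed

end

section \<open>Evaluation of series on the ball\<close>

text \<open>Square and triangle of partial sums differ by the terms indexed by \<open>S n\<close>.
  Their norm is at most K times the same difference for the real series of norms, which tends to 0
  by the Cauchy product of those series. The application is to composition of operators.\<close>

lemma (in bounded_bilinear) Cauchy_product_sums:
  assumes a: "summable (\<lambda>k. norm (a k))" and b: "summable (\<lambda>k. norm (b k))"
    and A: "a sums A" and B: "b sums B"
  shows "(\<lambda>k. \<Sum>i\<le>k. prod (a i) (b (k - i))) sums prod A B"
proof -
  obtain K where K: "\<And>x y. norm (prod x y) \<le> norm x * norm y * K" "0 \<le> K"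
    using nonneg_bounded by blast
  define S where "S n = {..<n} \<times> {..<n} - {(i, j). i + j < (n::nat)}" for n
  have sub: "{(i, j). i + j < n} \<subseteq> {..<n} \<times> {..<n}" for n :: nat by auto
  have split: "(\<Sum>i<n. \<Sum>j<n. F i j) = (\<Sum>(i, j)\<in>S n. F i j) + (\<Sum>k<n. \<Sum>i\<le>k. F i (k - i))"
    for F :: "nat \<Rightarrow> nat \<Rightarrow> 'z::comm_monoid_add" and n
    unfolding sum.triangle_reindex[symmetric] S_def
    by (subst sum.subset_diff[OF sub, symmetric]) (auto simp: sum.cartesian_product)
  define D where "D n = (\<Sum>(i, j)\<in>S n. norm (a i) * norm (b j))" for n
  have D: "D \<longlonglongrightarrow> 0"
  proof -
    have "(\<lambda>n. (\<Sum>i<n. norm (a i)) * (\<Sum>j<n. norm (b j)) - (\<Sum>k<n. \<Sum>i\<le>k. norm (a i) * norm (b (k - i))))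
        \<longlonglongrightarrow> (\<Sum>k. norm (a k)) * (\<Sum>k. norm (b k)) - (\<Sum>k. norm (a k)) * (\<Sum>k. norm (b k))"
      using Cauchy_product_sums[of "\<lambda>k. norm (a k)" "\<lambda>k. norm (b k)"] a b
      by (intro tendsto_intros summable_LIMSEQ) (simp_all add: sums_def)
    moreover have "(\<Sum>i<n. norm (a i)) * (\<Sum>j<n. norm (b j))
        - (\<Sum>k<n. \<Sum>i\<le>k. norm (a i) * norm (b (k - i))) = D n" for n
      unfolding sum_product split[of "\<lambda>i j. norm (a i) * norm (b j)" n] by (simp add: D_def)
    ultimately show ?thesis by simp
  qed
  have "(\<lambda>n. \<Sum>(i, j)\<in>S n. prod (a i) (b j)) \<longlonglongrightarrow> 0"
  proof (rule Lim_null_comparison)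
    have "norm (\<Sum>(i, j)\<in>S n. prod (a i) (b j)) \<le> D n * K" for n
      unfolding D_def sum_distrib_right
      by (intro order.trans[OF norm_sum] sum_mono) (auto simp: K)
    then show "\<forall>\<^sub>F n in sequentially. norm (\<Sum>(i, j)\<in>S n. prod (a i) (b j)) \<le> D n * K" by simp
    show "(\<lambda>n. D n * K) \<longlonglongrightarrow> 0"
      using tendsto_mult_left_zero[OF D] .
  qed
  moreover have "(\<lambda>n. prod (\<Sum>i<n. a i) (\<Sum>j<n. b j)) \<longlonglongrightarrow> prod A B"
    using A B by (intro tendsto) (simp_all add: sums_def)
  ultimately have "(\<lambda>n. prod (\<Sum>i<n. a i) (\<Sum>j<n. b j) - (\<Sum>(i, j)\<in>S n. prod (a i) (b j))) \<longlonglongrightarrow> prod A B - 0"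
    by (intro tendsto_diff)
  moreover have "prod (\<Sum>i<n. a i) (\<Sum>j<n. b j) - (\<Sum>(i, j)\<in>S n. prod (a i) (b j))
      = (\<Sum>k<n. \<Sum>i\<le>k. prod (a i) (b (k - i)))" for n
    unfolding sum_right sum_left split[of "\<lambda>i j. prod (a i) (b j)" n, symmetric]
    by (simp add: split[of "\<lambda>i j. prod (a i) (b j)" n] sum.swap[of _ "{..<n}" "{..<n}"])
  ultimately show ?thesis by (simp add: sums_def)
qed

section \<open>Geometric convergence of homogeneous expansions\<close>

text \<open>Keeps the witness \<rho> of \<open>nc_ball_iff\<close> visible, because it is the ratio
  of the geometric series in all convergence estimates.\<close>

definition row_bound :: "'h::complex_hilbert op ^ 'n::finite \<Rightarrow> real \<Rightarrow> bool" where
  "row_bound X \<rho> \<longleftrightarrow> (\<forall>i. X $ i \<in> bounded_ops) \<and> 0 \<le> \<rho> \<and> \<rho> < 1 \<and>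
    (\<forall>\<eta>. norm (\<Sum>i\<in>UNIV. blinfun_apply (X $ i) (\<eta> i)) \<le> \<rho> * sqrt (\<Sum>i\<in>UNIV. (norm (\<eta> i))\<^sup>2))"

lemma nc_ball_iff_row_bound: "X \<in> nc_ball \<longleftrightarrow> (\<exists>\<rho>. row_bound X \<rho>)"
  unfolding nc_ball_iff row_bound_def by blast

lemma word_op_scaleC:
  assumes "\<And>i. X $ i \<in> bounded_ops"
  shows "blinfun_apply (word_op X \<alpha>) (c *\<^sub>C x) = c *\<^sub>C blinfun_apply (word_op X \<alpha>) x"
  using assms by (induction \<alpha>) (simp_all add: bounded_ops_def)

lemma word_op_append: "word_op X (\<alpha> @ \<beta>) = word_op X \<alpha> o\<^sub>L word_op X \<beta>"
  by (induction \<alpha>) (auto intro!: blinfun_eqI)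

text \<open>The words of length k form a row again, and its bound is \<rho>^k: split off the first
  letter and apply the row bound of X to the inner sums w.\<close>

lemma row_bound_words:
  assumes X: "row_bound X \<rho>"
  shows "norm (\<Sum>\<alpha> | length \<alpha> = k. blinfun_apply (word_op X \<alpha>) (y \<alpha>))
    \<le> \<rho> ^ k * sqrt (\<Sum>\<alpha> | length \<alpha> = k. (norm (y \<alpha>))\<^sup>2)"
proof (induction k arbitrary: y)
  case (Suc k)
  have \<rho>: "0 \<le> \<rho>" using X by (simp add: row_bound_def)
  define w where "w i = (\<Sum>\<alpha> | length \<alpha> = k. blinfun_apply (word_op X \<alpha>) (y (i # \<alpha>)))" for i
  have "norm (\<Sum>\<alpha> | length \<alpha> = Suc k. blinfun_apply (word_op X \<alpha>) (y \<alpha>))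
      = norm (\<Sum>i\<in>UNIV. blinfun_apply (X $ i) (w i))"
    by (simp add: sum_words_eq_Suc w_def blinfun.sum_right)
  also have "\<dots> \<le> \<rho> * sqrt (\<Sum>i\<in>UNIV. (norm (w i))\<^sup>2)"
    using X by (simp add: row_bound_def)
  also have "\<dots> \<le> \<rho> * sqrt (\<Sum>i\<in>UNIV. (\<rho> ^ k * sqrt (\<Sum>\<alpha> | length \<alpha> = k. (norm (y (i # \<alpha>)))\<^sup>2))\<^sup>2)"
    unfolding w_def
    by (intro mult_left_mono real_sqrt_le_mono sum_mono power_mono Suc.IH \<rho> norm_ge_zero)
  also have "\<dots> = \<rho> * sqrt ((\<rho> ^ k)\<^sup>2 * (\<Sum>i\<in>UNIV. \<Sum>\<alpha> | length \<alpha> = k. (norm (y (i # \<alpha>)))\<^sup>2))"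
    by (simp add: power_mult_distrib sum_nonneg sum_distrib_left)
  also have "\<dots> = \<rho> ^ Suc k * sqrt (\<Sum>\<alpha> | length \<alpha> = Suc k. (norm (y \<alpha>))\<^sup>2)"
    unfolding sum_words_eq_Suc real_sqrt_mult by (simp add: \<rho>)
  finally show ?case .
qed simp

text \<open>Words are complex-linear, so the part of degree k at x is the row of words applied to
  the vectors a \<alpha> x. Square-summable coefficients therefore give geometric convergence on the
  ball.\<close>

lemma norm_homogeneous_part:
  assumes X: "row_bound X \<rho>"
  shows "norm (homogeneous_part a k X) \<le> \<rho> ^ k * sqrt (\<Sum>\<alpha> | length \<alpha> = k. (cmod (a \<alpha>))\<^sup>2)"
proof (rule norm_blinfun_bound)
  have B: "\<And>i. X $ i \<in> bounded_ops" and \<rho>: "0 \<le> \<rho>" using X by (simp_all add: row_bound_def)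
  then show "0 \<le> \<rho> ^ k * sqrt (\<Sum>\<alpha> | length \<alpha> = k. (cmod (a \<alpha>))\<^sup>2)"
    by (simp add: sum_nonneg)
  fix x
  have "norm (blinfun_apply (homogeneous_part a k X) x)
      = norm (\<Sum>\<alpha> | length \<alpha> = k. blinfun_apply (word_op X \<alpha>) (a \<alpha> *\<^sub>C x))"
    by (simp add: homogeneous_part_apply word_op_scaleC[OF B])
  also have "\<dots> \<le> \<rho> ^ k * sqrt (\<Sum>\<alpha> | length \<alpha> = k. (norm (a \<alpha> *\<^sub>C x))\<^sup>2)"
    by (rule row_bound_words[OF X])
  also have "\<dots> = \<rho> ^ k * sqrt ((\<Sum>\<alpha> | length \<alpha> = k. (cmod (a \<alpha>))\<^sup>2) * (norm x)\<^sup>2)"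
    by (simp add: norm_scaleC power_mult_distrib sum_distrib_right)
  finally show "norm (blinfun_apply (homogeneous_part a k X) x)
      \<le> \<rho> ^ k * sqrt (\<Sum>\<alpha> | length \<alpha> = k. (cmod (a \<alpha>))\<^sup>2) * norm x"
    by (simp add: real_sqrt_mult mult.assoc)
qed

lemma homogeneous_le_nsq: "(\<Sum>\<alpha> | length \<alpha> = k. (cmod (a \<alpha>))\<^sup>2) \<le> nsq (Suc k) (a :: 'n::finite list \<Rightarrow> complex)"
  unfolding nsq_def by (intro sum_mono2) auto

lemma homogeneous_part_bound:
  assumes X: "row_bound X \<rho>" and a: "\<And>N. nsq N a \<le> B"
  shows "norm (homogeneous_part a k X) \<le> \<rho> ^ k * sqrt B"
  using X homogeneous_le_nsq[of a k] a[of "Suc k"]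
  by (intro order.trans[OF norm_homogeneous_part[OF X]] mult_left_mono real_sqrt_le_mono)
    (auto simp: row_bound_def intro: order.trans)

lemma summable_norm_homogeneous_part:
  assumes X: "row_bound X \<rho>" and a: "\<And>N. nsq N a \<le> B"
  shows "summable (\<lambda>k. norm (homogeneous_part a k X))"
proof (rule summable_comparison_test')
  show "summable (\<lambda>k. \<rho> ^ k * sqrt B)"
    using X by (intro summable_mult2 summable_geometric) (simp add: row_bound_def)
qed (use homogeneous_part_bound[OF X a] in simp)

lemma summable_homogeneous_part:
  assumes "X \<in> nc_ball" and "\<And>N. nsq N a \<le> B"
  shows "summable (\<lambda>k. homogeneous_part a k X)"
  using assms summable_norm_homogeneous_part unfolding nc_ball_iff_row_bound
  by (blast intro: summable_norm_cancel)

lemma norm_suminf_homogeneous_part: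
  assumes X: "row_bound X \<rho>" and a: "\<And>N. nsq N a \<le> B" and s: "(\<lambda>k. homogeneous_part a k X) sums A"
  shows "norm A \<le> sqrt B / (1 - \<rho>)"
proof -
  have \<rho>: "0 \<le> \<rho>" "\<rho> < 1" using X by (simp_all add: row_bound_def)
  have g: "(\<lambda>k. \<rho> ^ k * sqrt B) sums (1 / (1 - \<rho>) * sqrt B)"
    by (intro sums_mult2 geometric_sums) (use \<rho> in simp)
  have sn: "summable (\<lambda>k. norm (homogeneous_part a k X))"
    by (rule summable_norm_homogeneous_part[OF X a])
  have "norm A \<le> (\<Sum>k. norm (homogeneous_part a k X))"
    using summable_norm[OF sn] s by (simp add: sums_iff)
  also have "\<dots> \<le> (\<Sum>k. \<rho> ^ k * sqrt B)"
    by (intro suminf_le homogeneous_part_bound[OF X a] sn sums_summable[OF g])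
  finally show ?thesis using g by (simp add: sums_iff)
qed

lemma limsup_root_le_1:
  assumes a: "\<And>N. nsq N a \<le> B"
  shows "limsup (\<lambda>k. ereal (root (2 * k) (\<Sum>\<alpha> | length \<alpha> = k. (cmod (a \<alpha>))\<^sup>2))) \<le> 1"
proof -
  \<comment> \<open>The roots of a constant tend to 1 only if it is positive, and B may be
    0.\<close>
  define B' where "B' = max B 1"
  have "limsup (\<lambda>k. ereal (root (2 * k) (\<Sum>\<alpha> | length \<alpha> = k. (cmod (a \<alpha>))\<^sup>2)))
      \<le> limsup (\<lambda>k. ereal (root (2 * k) B'))"
  proof (intro Limsup_mono always_eventually allI)
    fix k
    have "(\<Sum>\<alpha> | length \<alpha> = k. (cmod (a \<alpha>))\<^sup>2) \<le> B'"
      using homogeneous_le_nsq[of a k] a[of "Suc k"] by (simp add: B'_def le_max_iff_disj)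
    then show "ereal (root (2 * k) (\<Sum>\<alpha> | length \<alpha> = k. (cmod (a \<alpha>))\<^sup>2)) \<le> ereal (root (2 * k) B')"
      by (cases "k = 0") simp_all
  qed
  also have "\<dots> = 1"
  proof (rule lim_imp_Limsup)
    have "strict_mono (\<lambda>k::nat. 2 * k)" by (simp add: strict_mono_def)
    then have "(\<lambda>k. root (2 * k) B') \<longlonglongrightarrow> 1"
      using LIMSEQ_subseq_LIMSEQ[OF LIMSEQ_root_const[of B']] by (simp add: B'_def o_def)
    then show "(\<lambda>k. ereal (root (2 * k) B')) \<longlonglongrightarrow> 1"
      by (simp add: one_ereal_def)
  qed simp
  finally show ?thesis .
qed

lemma has_free_seriesI:
  assumes "\<And>N. nsq N a \<le> B" and "\<And>X. X \<in> nc_ball \<Longrightarrow> (\<lambda>k. homogeneous_part a k X) sums f X"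
  shows "has_free_series f a"
  using assms limsup_root_le_1[of a B] by (simp add: has_free_series_def)

lemma homogeneous_part_0: "homogeneous_part a 0 X = op_scaleC (a []) id_blinfun"
  by (simp add: homogeneous_part_def)

lemma homogeneous_part_Suc:
  assumes "\<And>i. Y $ i \<in> bounded_ops"
  shows "homogeneous_part f (Suc k) Y = (\<Sum>i\<in>UNIV. Y $ i o\<^sub>L homogeneous_part (\<lambda>\<alpha>. f (i # \<alpha>)) k Y)"
proof (rule blinfun_eqI)
  have c: "blinfun_apply (Y $ i) (c *\<^sub>C x) = c *\<^sub>C blinfun_apply (Y $ i) x" for i c x
    using assms by (simp add: bounded_ops_def)
  fix x
  show "blinfun_apply (homogeneous_part f (Suc k) Y) x
      = blinfun_apply (\<Sum>i\<in>UNIV. Y $ i o\<^sub>L homogeneous_part (\<lambda>\<alpha>. f (i # \<alpha>)) k Y) x"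
    by (simp add: homogeneous_part_apply sum_words_eq_Suc blinfun.sum_left blinfun.sum_right c)
qed

lemma homogeneous_part_add:
  "homogeneous_part (\<lambda>\<alpha>. a \<alpha> + b \<alpha>) k X = homogeneous_part a k X + homogeneous_part b k X"
  by (rule blinfun_eqI)
    (simp add: homogeneous_part_apply blinfun.add_left scaleC_add_left sum.distrib)

lemma homogeneous_part_diff:
  "homogeneous_part (\<lambda>\<alpha>. a \<alpha> - b \<alpha>) k X = homogeneous_part a k X - homogeneous_part b k X"
  using homogeneous_part_add[of "\<lambda>\<alpha>. a \<alpha> - b \<alpha>" b k X] by simp

lemma homogeneous_part_scale:
  "homogeneous_part (\<lambda>\<alpha>. c * a \<alpha>) k X = op_scaleC c (homogeneous_part a k X)"
  by (rule blinfun_eqI) (simp add: homogeneous_part_apply op_scaleC_apply cvec.scale_sum_right)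

lemma homogeneous_part_sum:
  "homogeneous_part (\<lambda>\<alpha>. \<Sum>i\<in>I. a i \<alpha>) k X = (\<Sum>i\<in>I. homogeneous_part (a i) k X)"
  by (rule blinfun_eqI)
    (simp add: homogeneous_part_apply blinfun.sum_left cvec.scale_sum_left sum.swap[of _ I])

lemma homogeneous_part_unit_sums: "(\<lambda>k. homogeneous_part unit_series k X) sums id_blinfun"
proof -
  have "homogeneous_part unit_series k X = (if k = 0 then id_blinfun else 0)" for k
    by (rule blinfun_eqI) (auto simp: homogeneous_part_apply unit_series_def intro!: sum.neutral)
  then show ?thesis
    using sums_single[of 0 "\<lambda>_. id_blinfun"] by (simp add: eq_commute)
qed

lemma bounded_linear_op_scaleC: "bounded_linear (op_scaleC c)"
proof (rule bounded_linear_intro[where K = "cmod c"])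
  fix T :: "'a op"
  show "norm (op_scaleC c T) \<le> norm T * cmod c"
  proof (rule norm_blinfun_bound)
    show "norm (blinfun_apply (op_scaleC c T) x) \<le> norm T * cmod c * norm x" for x
      using mult_left_mono[OF norm_blinfun[of T x], of "cmod c"]
      by (simp add: op_scaleC_apply norm_scaleC mult_ac)
  qed simp
qed (auto intro!: blinfun_eqI simp: op_scaleC_apply blinfun.add_left blinfun.scaleR_left
    scaleC_add_right scaleR_scaleC scaleC_scaleC mult.commute)

lemma sum_split_words:
  assumes "m \<le> k"
  shows "(\<Sum>\<gamma> | length \<gamma> = k. F (take m \<gamma>) (drop m (\<gamma> :: 'n::finite list)))
    = (\<Sum>\<alpha> | length \<alpha> = m. \<Sum>\<beta> | length \<beta> = k - m. F \<alpha> \<beta>)"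
proof -
  have "(\<Sum>\<alpha> | length \<alpha> = m. \<Sum>\<beta> | length \<beta> = k - m. F \<alpha> \<beta>)
      = (\<Sum>(\<alpha>, \<beta>)\<in>{\<alpha>. length \<alpha> = m} \<times> {\<beta>. length \<beta> = k - m}. F \<alpha> \<beta>)"
    by (simp add: sum.cartesian_product)
  also have "\<dots> = (\<Sum>\<gamma> | length \<gamma> = k. F (take m \<gamma>) (drop m \<gamma>))"
    by (rule sum.reindex_bij_witness[where j = "\<lambda>(\<alpha>, \<beta>). \<alpha> @ \<beta>" and i = "\<lambda>\<gamma>. (take m \<gamma>, drop m \<gamma>)"])
      (use assms in auto)
  finally show ?thesis ..
qed

lemma homogeneous_part_convolve:
  assumes B: "\<And>i. X $ i \<in> bounded_ops"
  shows "homogeneous_part (convolve p g) k X = (\<Sum>m\<le>k. homogeneous_part p m X o\<^sub>L homogeneous_part g (k - m) X)"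
proof (rule blinfun_eqI)
  fix x
  have "blinfun_apply (homogeneous_part (convolve p g) k X) x
      = (\<Sum>\<gamma> | length \<gamma> = k. \<Sum>m\<le>k. (p (take m \<gamma>) * g (drop m \<gamma>)) *\<^sub>C blinfun_apply (word_op X (take m \<gamma> @ drop m \<gamma>)) x)"
    unfolding homogeneous_part_apply convolve_def by (intro sum.cong refl) (auto simp: cvec.scale_sum_left)
  also have "\<dots> = (\<Sum>m\<le>k. \<Sum>\<gamma> | length \<gamma> = k. (p (take m \<gamma>) * g (drop m \<gamma>)) *\<^sub>C blinfun_apply (word_op X (take m \<gamma> @ drop m \<gamma>)) x)"
    by (rule sum.swap)
  also have "\<dots> = (\<Sum>m\<le>k. \<Sum>\<alpha> | length \<alpha> = m. \<Sum>\<beta> | length \<beta> = k - m.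
      (p \<alpha> * g \<beta>) *\<^sub>C blinfun_apply (word_op X (\<alpha> @ \<beta>)) x)"
    by (intro sum.cong refl
        sum_split_words[where F = "\<lambda>\<alpha> \<beta>. (p \<alpha> * g \<beta>) *\<^sub>C blinfun_apply (word_op X (\<alpha> @ \<beta>)) x"]) simp
  also have "\<dots> = blinfun_apply (\<Sum>m\<le>k. homogeneous_part p m X o\<^sub>L homogeneous_part g (k - m) X) x"
    by (simp add: blinfun.sum_left homogeneous_part_apply blinfun.sum_right word_op_append
        word_op_scaleC[OF B] cvec.scale_sum_right scaleC_scaleC)
      (rule sum.cong[OF refl], rule sum.swap)
  finally show "blinfun_apply (homogeneous_part (convolve p g) k X) x
      = blinfun_apply (\<Sum>m\<le>k. homogeneous_part p m X o\<^sub>L homogeneous_part g (k - m) X) x" .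
qed

lemma homogeneous_part_convolve_sums:
  assumes X: "X \<in> nc_ball" and p: "\<And>N. nsq N p \<le> B" and g: "\<And>N. nsq N g \<le> B'"
    and P: "(\<lambda>k. homogeneous_part p k X) sums P" and G: "(\<lambda>k. homogeneous_part g k X) sums G"
  shows "(\<lambda>k. homogeneous_part (convolve p g) k X) sums (P o\<^sub>L G)"
proof -
  obtain \<rho> where \<rho>: "row_bound X \<rho>" using X nc_ball_iff_row_bound by blast
  then have B: "\<And>i. X $ i \<in> bounded_ops" by (simp add: row_bound_def)
  show ?thesis
    unfolding homogeneous_part_convolve[OF B]
    by (rule bounded_bilinear.Cauchy_product_sums[OF bounded_bilinear_blinfun_compose
          summable_norm_homogeneous_part[OF \<rho> p] summable_norm_homogeneous_part[OF \<rho> g] P G])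
qed

section \<open>Formal substitution as composition of functions\<close>

context row_contraction
begin

text \<open>Apply the contraction to the row with the constant 1 in position i and 0 elsewhere; its
  image is p i.\<close>

lemma nsq_coefficient: "nsq N (p i) \<le> 1"
proof -
  define \<eta> :: "'n \<Rightarrow> 'n list \<Rightarrow> complex"
    where "\<eta> j = (if j = i then unit_series else (\<lambda>_. 0))" for j
  have "nsq N (\<lambda>\<gamma>. \<Sum>j\<in>UNIV. convolve (p j) (\<eta> j) \<gamma>) \<le> (\<Sum>j\<in>UNIV. nsq N (\<eta> j))"
    by (rule contraction)
  also have "(\<lambda>\<gamma>. \<Sum>j\<in>UNIV. convolve (p j) (\<eta> j) \<gamma>) = p i"
  proof
    fix \<gamma>
    have "(\<Sum>j\<in>UNIV. convolve (p j) (\<eta> j) \<gamma>) = (\<Sum>j\<in>UNIV. if j = i then p j \<gamma> else 0)"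
      by (intro sum.cong refl) (simp add: \<eta>_def)
    then show "(\<Sum>j\<in>UNIV. convolve (p j) (\<eta> j) \<gamma>) = p i \<gamma>" by simp
  qed
  also have "(\<Sum>j\<in>UNIV. nsq N (\<eta> j)) = (\<Sum>j\<in>UNIV. if j = i then nsq N (unit_series :: 'n list \<Rightarrow> complex) else 0)"
    by (intro sum.cong refl) (simp add: \<eta>_def)
  also have "\<dots> = nsq N (unit_series :: 'n list \<Rightarrow> complex)"
    by simp
  also have "\<dots> \<le> 1"
    by (cases N) (simp_all add: nsq_Suc unit_series_def)
  finally show ?thesis .
qed

text \<open>Links formal substitution to operators, with Y in the role of \<phi>(X). Each Horner
  step is a Cauchy product, whose absolute convergence rests on \<open>nsq_coefficient\<close> for p
  i and on \<open>nsq_subst_series\<close> for the inner composition.\<close>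

lemma subst_series_sums:
  assumes X: "X \<in> nc_ball" and Y: "Y \<in> nc_ball"
    and p: "\<And>i. (\<lambda>k. homogeneous_part (p i) k X) sums (Y $ i)"
  shows "(\<lambda>k. homogeneous_part (subst_series p d f) k X) sums (\<Sum>k<d. homogeneous_part f k Y)"
proof (induction d arbitrary: f)
  case 0
  then show ?case by (simp add: homogeneous_part_def op_scaleC_def zero_blinfun_def[symmetric])
next
  case (Suc d)
  have B: "\<And>i. Y $ i \<in> bounded_ops" using Y nc_ball_iff by blast
  have step: "(\<lambda>k. homogeneous_part (convolve (p i) (subst_series p d (\<lambda>\<alpha>. f (i # \<alpha>)))) k X)
      sums (Y $ i o\<^sub>L (\<Sum>k<d. homogeneous_part (\<lambda>\<alpha>. f (i # \<alpha>)) k Y))" for i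
    by (rule homogeneous_part_convolve_sums[OF X nsq_coefficient nsq_subst_series p Suc.IH])
  have "(\<lambda>k. homogeneous_part (subst_series p (Suc d) f) k X)
      sums (op_scaleC (f []) id_blinfun + (\<Sum>i\<in>UNIV. Y $ i o\<^sub>L (\<Sum>k<d. homogeneous_part (\<lambda>\<alpha>. f (i # \<alpha>)) k Y)))"
    unfolding subst_series.simps homogeneous_part_add homogeneous_part_sum homogeneous_part_scale
    by (intro sums_add sums_sum step bounded_linear.sums[OF bounded_linear_op_scaleC] homogeneous_part_unit_sums)
  also have "op_scaleC (f []) id_blinfun + (\<Sum>i\<in>UNIV. Y $ i o\<^sub>L (\<Sum>k<d. homogeneous_part (\<lambda>\<alpha>. f (i # \<alpha>)) k Y))
      = (\<Sum>k<Suc d. homogeneous_part f k Y)"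
    unfolding sum.lessThan_Suc_shift homogeneous_part_0 homogeneous_part_Suc[OF B]
    by (subst sum.swap) (simp add: bounded_bilinear.sum_right[OF bounded_bilinear_blinfun_compose])
  finally show ?case .
qed

text \<open>The difference is the composition with the part of a of lengths from K to below L. The
  squared norm of that part is the difference of the truncated ones, since it shares no words with
  the part below K.\<close>

lemma subst_series_tail:
  assumes "K \<le> L"
  shows "nsq N (\<lambda>\<gamma>. subst_series p L a \<gamma> - subst_series p K a \<gamma>) \<le> (1 + r) / (1 - r) * (nsq L a - nsq K a)"
proof -
  define a' where "a' \<alpha> = (if length \<alpha> < K then a \<alpha> else 0)" for \<alpha>
  have "subst_series p K a = subst_series p K a'"
    by (rule subst_series_cong) (simp add: a'_def)
  also have "\<dots> = subst_series p L a'"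
    by (rule subst_series_supported[symmetric]) (use assms in \<open>auto simp: a'_def\<close>)
  finally have "(\<lambda>\<gamma>. subst_series p L a \<gamma> - subst_series p K a \<gamma>) = subst_series p L (\<lambda>\<alpha>. a \<alpha> - a' \<alpha>)"
    by (simp add: subst_series_diff)
  then have "nsq N (\<lambda>\<gamma>. subst_series p L a \<gamma> - subst_series p K a \<gamma>) \<le> (1 + r) / (1 - r) * nsq L (\<lambda>\<alpha>. a \<alpha> - a' \<alpha>)"
    using nsq_subst_series by simp
  also have "nsq L (\<lambda>\<alpha>. a \<alpha> - a' \<alpha>) = nsq L a - nsq K a"
  proof -
    have "nsq L (\<lambda>\<alpha>. a \<alpha> - a' \<alpha>) = (\<Sum>\<alpha>\<in>words L. (cmod (a \<alpha>))\<^sup>2 - (cmod (a' \<alpha>))\<^sup>2)"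
      unfolding nsq_def by (intro sum.cong) (auto simp: a'_def)
    also have "\<dots> = nsq L a - (\<Sum>\<alpha>\<in>words L. (cmod (a' \<alpha>))\<^sup>2)"
      by (simp add: nsq_def sum_subtractf)
    also have "(\<Sum>\<alpha>\<in>words L. (cmod (a' \<alpha>))\<^sup>2) = (\<Sum>\<alpha>\<in>words K. (cmod (a \<alpha>))\<^sup>2)"
      by (intro sum.mono_neutral_cong_right) (use assms in \<open>auto simp: a'_def\<close>)
    finally show ?thesis by (simp add: nsq_def)
  qed
  finally show ?thesis .
qed

text \<open>The composition with an infinite series is the coefficientwise limit of the compositions with
  its partial sums.\<close>

lemma composition_series:
  assumes a: "\<And>N. nsq N a \<le> A" and lim: "(\<lambda>N. nsq N a) \<longlonglongrightarrow> A"
  obtains b where "\<And>N. nsq N b \<le> (1 + r) / (1 - r) * A"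
    and "\<And>X Y. \<lbrakk>X \<in> nc_ball; Y \<in> nc_ball; \<And>i. (\<lambda>k. homogeneous_part (p i) k X) sums (Y $ i)\<rbrakk>
      \<Longrightarrow> (\<lambda>k. homogeneous_part b k (X :: 'h::complex_hilbert op ^ 'n)) sums (\<Sum>k. homogeneous_part a k Y)"
proof -
  define C where "C = (1 + r) / (1 - r)"
  have C: "0 \<le> C" using r_nonneg r_less by (simp add: C_def)
  \<comment> \<open>Bounds the squared norm of every difference s L - s K with K \<le> L, uniformly
    in N and L. The hypothesis on A makes it tend to 0.\<close>
  define E where "E K = C * (A - nsq K a)" for K
  define s where "s K = subst_series p K a" for K
  have E: "E \<longlonglongrightarrow> 0"
    unfolding E_def by (rule tendsto_eq_intros lim refl | simp)+
  have tail: "nsq N (\<lambda>\<gamma>. s L \<gamma> - s K \<gamma>) \<le> E K" if "K \<le> L" for K L N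
    using subst_series_tail[OF that, of N a] mult_left_mono[OF a[of L] C]
    unfolding s_def E_def C_def by (simp add: right_diff_distrib)
  have dist: "(cmod (s L \<gamma> - s K \<gamma>))\<^sup>2 \<le> E K" if "K \<le> L" for K L \<gamma>
  proof -
    have "(cmod (s L \<gamma> - s K \<gamma>))\<^sup>2 \<le> nsq (Suc (length \<gamma>)) (\<lambda>\<gamma>. s L \<gamma> - s K \<gamma>)"
      unfolding nsq_def by (rule member_le_sum) auto
    also note tail[OF that]
    finally show ?thesis .
  qed
  have "convergent (\<lambda>K. s K \<gamma>)" for \<gamma>
  proof (rule Cauchy_convergent, rule metric_CauchyI)
    fix e :: real assume e: "e > 0"
    then have "\<forall>\<^sub>F K in sequentially. E K < e\<^sup>2"
      using order_tendstoD(2)[OF E, of "e\<^sup>2"] by simp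
    then obtain M where M: "\<And>K. K \<ge> M \<Longrightarrow> E K < e\<^sup>2"
      by (auto simp: eventually_sequentially)
    have near: "dist (s k \<gamma>) (s l \<gamma>) < e" if "M \<le> k" "k \<le> l" for k l
    proof -
      have "(cmod (s l \<gamma> - s k \<gamma>))\<^sup>2 < e\<^sup>2"
        using dist[OF that(2)] M[OF that(1)] by (rule order.strict_trans1)
      then have "cmod (s l \<gamma> - s k \<gamma>) < e"
        using e by (simp add: power2_less_imp_less)
      then show ?thesis by (simp add: dist_norm norm_minus_commute)
    qed
    show "\<exists>M. \<forall>k\<ge>M. \<forall>l\<ge>M. dist (s k \<gamma>) (s l \<gamma>) < e"
      using near by (metis dist_commute nat_le_linear)
  qed
  then obtain b where b: "\<And>\<gamma>. (\<lambda>K. s K \<gamma>) \<longlonglongrightarrow> b \<gamma>"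
    unfolding convergent_def by metis
  have b_tail: "nsq N (\<lambda>\<gamma>. b \<gamma> - s K \<gamma>) \<le> E K" for N K
  proof (rule LIMSEQ_le_const2)
    show "(\<lambda>L. nsq N (\<lambda>\<gamma>. s L \<gamma> - s K \<gamma>)) \<longlonglongrightarrow> nsq N (\<lambda>\<gamma>. b \<gamma> - s K \<gamma>)"
      unfolding nsq_def by (intro tendsto_intros b)
  qed (use tail in blast)
  have b_bound: "nsq N b \<le> C * A" for N
  proof (rule LIMSEQ_le_const2)
    show "(\<lambda>L. nsq N (s L)) \<longlonglongrightarrow> nsq N b"
      unfolding nsq_def by (intro tendsto_intros b)
    show "\<exists>M. \<forall>L\<ge>M. nsq N (s L) \<le> C * A"
      using nsq_subst_series mult_left_mono[OF a C] unfolding s_def C_def by (meson order.trans)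
  qed
  show thesis
  proof
    show "nsq N b \<le> (1 + r) / (1 - r) * A" for N using b_bound unfolding C_def .
    fix X Y :: "'h op ^ 'n"
    assume X: "X \<in> nc_ball" and Y: "Y \<in> nc_ball"
      and p: "\<And>i. (\<lambda>k. homogeneous_part (p i) k X) sums (Y $ i)"
    obtain \<rho> where \<rho>: "row_bound X \<rho>" using X nc_ball_iff_row_bound by blast
    obtain V where V: "(\<lambda>k. homogeneous_part b k X) sums V"
      using summable_homogeneous_part[OF X b_bound] by (auto simp: summable_def)
    \<comment> \<open>Evaluation at X costs a factor 1 / (1 - \<rho>), so smallness of the
      coefficients of b - s K becomes operator norm convergence of the partial sums of a at Y to
      V.\<close>
    have "(\<lambda>k. homogeneous_part (\<lambda>\<gamma>. b \<gamma> - s K \<gamma>) k X) sums (V - (\<Sum>k<K. homogeneous_part a k Y))" for K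
      unfolding homogeneous_part_diff s_def by (intro sums_diff V subst_series_sums[OF X Y p])
    then have "norm (V - (\<Sum>k<K. homogeneous_part a k Y)) \<le> sqrt (E K) / (1 - \<rho>)" for K
      using norm_suminf_homogeneous_part[OF \<rho> b_tail] by blast
    then have "\<forall>\<^sub>F K in sequentially. norm ((\<Sum>k<K. homogeneous_part a k Y) - V) \<le> sqrt (E K) / (1 - \<rho>)"
      by (simp add: norm_minus_commute)
    moreover have "(\<lambda>K. sqrt (E K) / (1 - \<rho>)) \<longlonglongrightarrow> 0"
      using tendsto_divide[OF tendsto_real_sqrt[OF E] tendsto_const[of "1 - \<rho>"]] \<rho>
      by (simp add: row_bound_def)
    ultimately have "(\<lambda>K. (\<Sum>k<K. homogeneous_part a k Y) - V) \<longlonglongrightarrow> 0"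
      by (rule Lim_null_comparison)
    then have "(\<lambda>k. homogeneous_part a k Y) sums V"
      unfolding sums_def by (rule LIM_zero_cancel)
    then show "(\<lambda>k. homogeneous_part b k X) sums (\<Sum>k. homogeneous_part a k Y)"
      using V by (simp add: sums_iff)
  qed
qed

end

section \<open>Composition on the Hardy space\<close>

lemma nsq_le_infsum:
  assumes "(\<lambda>\<alpha>. (cmod (a \<alpha>))\<^sup>2) summable_on UNIV"
  shows "nsq N a \<le> (\<Sum>\<^sub>\<infinity>\<alpha>. (cmod (a \<alpha>))\<^sup>2)"
  unfolding nsq_def by (rule finite_sum_le_infsum[OF assms]) auto

lemma finite_subset_words:
  assumes "finite (F :: 'n::finite list set)"
  shows "\<exists>M. \<forall>N\<ge>M. F \<subseteq> words N"
proof (intro exI allI impI subsetI)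
  fix N \<alpha> assume N: "Suc (Max (length ` F)) \<le> N" and "\<alpha> \<in> F"
  then have "length \<alpha> \<le> Max (length ` F)"
    using assms by (intro Max_ge) auto
  then show "\<alpha> \<in> words N" using N by simp
qed

lemma nsq_tendsto_infsum:
  fixes a :: "'n::finite list \<Rightarrow> complex"
  assumes "(\<lambda>\<alpha>. (cmod (a \<alpha>))\<^sup>2) summable_on UNIV"
  shows "(\<lambda>N. nsq N a) \<longlonglongrightarrow> (\<Sum>\<^sub>\<infinity>\<alpha>. (cmod (a \<alpha>))\<^sup>2)"
proof -
  have "filterlim (words :: nat \<Rightarrow> 'n list set) (finite_subsets_at_top UNIV) sequentially"
    unfolding filterlim_finite_subsets_at_top eventually_sequentially
    using finite_subset_words by auto
  from filterlim_compose[OF infsum_tendsto[OF assms] this] show ?thesis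
    by (simp add: nsq_def)
qed

lemma summable_on_if_nsq_bounded:
  fixes a :: "'n::finite list \<Rightarrow> complex"
  assumes "\<And>N. nsq N a \<le> B"
  shows "(\<lambda>\<alpha>. (cmod (a \<alpha>))\<^sup>2) summable_on UNIV"
proof (rule nonneg_bdd_above_summable_on)
  show "bdd_above (sum (\<lambda>\<alpha>. (cmod (a \<alpha>))\<^sup>2) ` {F. F \<subseteq> UNIV \<and> finite F})"
  proof (rule bdd_aboveI2)
    fix F :: "'n list set" assume "F \<in> {F. F \<subseteq> UNIV \<and> finite F}"
    then obtain M where "F \<subseteq> words M" using finite_subset_words[of F] by auto
    then have "(\<Sum>\<alpha>\<in>F. (cmod (a \<alpha>))\<^sup>2) \<le> nsq M a"
      unfolding nsq_def by (intro sum_mono2) auto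
    then show "(\<Sum>\<alpha>\<in>F. (cmod (a \<alpha>))\<^sup>2) \<le> B" using assms order.trans by blast
  qed
qed simp

lemma H2_ballD:
  fixes f :: "'h::complex_hilbert op ^ 'n::finite \<Rightarrow> 'h op"
  assumes inf: "infinite_dimensional TYPE('h)" and f: "f \<in> H2_ball"
  shows "has_free_series f (free_coeff f)"
    and "nsq N (free_coeff f) \<le> (H2_norm f)\<^sup>2"
    and "(\<lambda>N. nsq N (free_coeff f)) \<longlonglongrightarrow> (H2_norm f)\<^sup>2"
proof -
  show "has_free_series f (free_coeff f)"
    using f free_coeff_eq[OF inf] unfolding H2_ball_def free_holomorphic_def by force
  have s: "(\<lambda>\<alpha>. (cmod (free_coeff f \<alpha>))\<^sup>2) summable_on UNIV"
    using f by (simp add: H2_ball_def)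
  have "(H2_norm f)\<^sup>2 = (\<Sum>\<^sub>\<infinity>\<alpha>. (cmod (free_coeff f \<alpha>))\<^sup>2)"
    by (simp add: H2_norm_def infsum_nonneg)
  with nsq_le_infsum[OF s] nsq_tendsto_infsum[OF s]
  show "nsq N (free_coeff f) \<le> (H2_norm f)\<^sup>2" "(\<lambda>N. nsq N (free_coeff f)) \<longlonglongrightarrow> (H2_norm f)\<^sup>2"
    by simp_all
qed

text \<open>Membership is proved by exhibiting coefficients: boundedness of \<open>nsq\<close>
  yields the root condition and summability, and uniqueness identifies
  \<open>free_coeff\<close>.\<close>

lemma H2_ballI:
  fixes f :: "'h::complex_hilbert op ^ 'n::finite \<Rightarrow> 'h op"
  assumes inf: "infinite_dimensional TYPE('h)"
    and a: "\<And>N. nsq N a \<le> B" and s: "\<And>X. X \<in> nc_ball \<Longrightarrow> (\<lambda>k. homogeneous_part a k X) sums f X"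
  shows "f \<in> H2_ball" and "free_coeff f = a" and "(H2_norm f)\<^sup>2 \<le> B"
proof -
  have h: "has_free_series f a" by (rule has_free_seriesI[OF a s])
  then show c: "free_coeff f = a" by (rule free_coeff_eq[OF inf])
  then show f: "f \<in> H2_ball"
    using h summable_on_if_nsq_bounded[OF a] by (auto simp: H2_ball_def free_holomorphic_def)
  show "(H2_norm f)\<^sup>2 \<le> B"
    using H2_ballD(3)[OF inf f] a unfolding c by (intro LIMSEQ_le_const2) auto
qed

lemma H2_norm_nonneg: "0 \<le> H2_norm f"
  by (simp add: H2_norm_def infsum_nonneg)

lemma free_series_sums:
  assumes "has_free_series f a" and "X \<in> nc_ball"
  shows "(\<lambda>k. homogeneous_part a k X) sums f X"
  using assms by (simp add: has_free_series_def)

section \<open>Scalar points and evaluation bounds\<close>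

definition scalar_point :: "complex ^ 'n \<Rightarrow> 'h::complex_hilbert op ^ 'n::finite" where
  "scalar_point \<zeta> = (\<chi> i. op_scaleC (\<zeta> $ i) id_blinfun)"

primrec monomial :: "complex ^ 'n::finite \<Rightarrow> 'n list \<Rightarrow> complex" where
  "monomial \<zeta> [] = 1"
| "monomial \<zeta> (i # \<alpha>) = \<zeta> $ i * monomial \<zeta> \<alpha>"

lemma monomial_append: "monomial \<zeta> (\<alpha> @ \<beta>) = monomial \<zeta> \<alpha> * monomial \<zeta> \<beta>"
  by (induction \<alpha>) simp_all

lemma scalar_point_apply [simp]: "blinfun_apply (scalar_point \<zeta> $ i) x = \<zeta> $ i *\<^sub>C x"
  by (simp add: scalar_point_def op_scaleC_apply)

lemma scalar_point_0: "scalar_point 0 = 0"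
  by (simp add: vec_eq_iff) (auto intro!: blinfun_eqI)

lemma word_op_scalar_point: "blinfun_apply (word_op (scalar_point \<zeta>) \<alpha>) x = monomial \<zeta> \<alpha> *\<^sub>C x"
  by (induction \<alpha>) (simp_all add: scaleC_scaleC)

lemma homogeneous_part_scalar_point:
  "homogeneous_part a k (scalar_point \<zeta>) = op_scaleC (\<Sum>\<alpha> | length \<alpha> = k. a \<alpha> * monomial \<zeta> \<alpha>) id_blinfun"
  by (rule blinfun_eqI)
    (simp add: homogeneous_part_apply word_op_scalar_point op_scaleC_apply scaleC_scaleC cvec.scale_sum_left)

lemma norm_cvec_sq: "(norm (\<zeta> :: complex ^ 'n::finite))\<^sup>2 = (\<Sum>i\<in>UNIV. (cmod (\<zeta> $ i))\<^sup>2)"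
  by (simp add: norm_vec_def L2_set_def sum_nonneg)

lemma unit_vector_exists:
  assumes "infinite_dimensional TYPE('h::complex_hilbert)"
  shows "\<exists>e :: 'h. cinner e e = 1"
  using exists_orthonormal[OF assms, of "{()}"] by auto

lemma scalar_point_in_nc_ball_iff:
  assumes inf: "infinite_dimensional TYPE('h::complex_hilbert)"
  shows "(scalar_point \<zeta> :: 'h op ^ 'n::finite) \<in> nc_ball \<longleftrightarrow> norm \<zeta> < 1"
proof
  assume "(scalar_point \<zeta> :: 'h op ^ 'n) \<in> nc_ball"
  then obtain \<rho> where \<rho>: "0 \<le> \<rho>" "\<rho> < 1"
    and row: "\<And>\<eta>. norm (\<Sum>i\<in>UNIV. blinfun_apply ((scalar_point \<zeta> :: 'h op ^ 'n) $ i) (\<eta> i))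
      \<le> \<rho> * sqrt (\<Sum>i\<in>UNIV. (norm (\<eta> i))\<^sup>2)"
    unfolding nc_ball_iff by blast
  obtain e :: 'h where "cinner e e = 1" using unit_vector_exists[OF inf] by blast
  then have "complex_of_real ((norm e)\<^sup>2) = complex_of_real 1" by (simp only: cinner_self of_real_1)
  then have "(norm e)\<^sup>2 = 1" by (simp only: of_real_eq_iff)
  then have e: "norm e = 1" using power2_eq_iff_nonneg[of "norm e" 1] by simp
  \<comment> \<open>The row of scalars attains its norm at \<eta>_i = conj \<zeta>_i e; the row
    bound there reads |\<zeta>|^2 \<le> \<rho> |\<zeta>|.\<close>
  have "(\<Sum>i\<in>UNIV. \<zeta> $ i *\<^sub>C cnj (\<zeta> $ i) *\<^sub>C e) = complex_of_real ((norm \<zeta>)\<^sup>2) *\<^sub>C e"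
    unfolding norm_cvec_sq of_real_sum complex_norm_square by (simp add: scaleC_scaleC cvec.scale_sum_left)
  then have "norm (complex_of_real ((norm \<zeta>)\<^sup>2) *\<^sub>C e) \<le> \<rho> * sqrt ((norm \<zeta>)\<^sup>2)"
    using row[of "\<lambda>i. cnj (\<zeta> $ i) *\<^sub>C e"] by (simp add: norm_scaleC e norm_cvec_sq)
  then have "norm \<zeta> * norm \<zeta> \<le> \<rho> * norm \<zeta>"
    unfolding norm_scaleC norm_of_real e by (simp add: power2_eq_square)
  then show "norm \<zeta> < 1"
    using \<rho> by (cases "norm \<zeta> = 0") (simp_all add: mult_le_cancel_right)
next
  assume \<zeta>: "norm \<zeta> < 1"
  have "norm (\<Sum>i\<in>UNIV. \<zeta> $ i *\<^sub>C \<eta> i) \<le> norm \<zeta> * sqrt (\<Sum>i\<in>UNIV. (norm (\<eta> i))\<^sup>2)" for \<eta> :: "'n \<Rightarrow> 'h"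
  proof -
    have "norm (\<Sum>i\<in>UNIV. \<zeta> $ i *\<^sub>C \<eta> i) \<le> (\<Sum>i\<in>UNIV. norm (\<zeta> $ i) * norm (\<eta> i))"
      by (rule order.trans[OF norm_sum]) (simp add: norm_scaleC)
    also have "\<dots> \<le> norm \<zeta> * sqrt (\<Sum>i\<in>UNIV. (norm (\<eta> i))\<^sup>2)"
      using sum_norm_mult_le[of "\<lambda>i. \<zeta> $ i" \<eta> UNIV] by (simp add: norm_vec_def L2_set_def)
    finally show ?thesis .
  qed
  then show "(scalar_point \<zeta> :: 'h op ^ 'n) \<in> nc_ball"
    unfolding nc_ball_iff using \<zeta>
    by (intro conjI allI exI[of _ "norm \<zeta>"])
      (simp_all add: bounded_ops_def scaleC_scaleC mult.commute)
qed

text \<open>Testing against a unit vector turns the operator series into a scalar series, whose sum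
  then gives the limit on every vector. This is why self maps send scalar points to scalar
  points.\<close>

lemma scalar_sums:
  assumes inf: "infinite_dimensional TYPE('h::complex_hilbert)"
    and s: "(\<lambda>k. op_scaleC (c k) (id_blinfun :: 'h op)) sums Y"
  obtains d where "c sums d" and "Y = op_scaleC d id_blinfun"
proof -
  obtain e :: 'h where e: "cinner e e = 1" using unit_vector_exists[OF inf] by blast
  have app: "(\<lambda>k. c k *\<^sub>C x) sums blinfun_apply Y x" for x
    using bounded_linear.sums[OF blinfun.bounded_linear_left s] by (simp add: op_scaleC_apply)
  define d where "d = cinner (blinfun_apply Y e) e"
  have d: "c sums d"
    using bounded_linear.sums[OF bounded_linear_cinner_left app[of e], of e]
    by (simp add: cinner_scaleC_left e d_def)
  have "blinfun_apply Y x = d *\<^sub>C x" for x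
  proof -
    have "bounded_linear (\<lambda>c. c *\<^sub>C x)"
      by (rule bounded_linear_intro[where K = "norm x"])
        (simp_all add: scaleC_add_left scaleR_scaleC scaleC_scaleC norm_scaleC scaleR_conv_of_real)
    from sums_unique2[OF app bounded_linear.sums[OF this d]] show ?thesis .
  qed
  then have "Y = op_scaleC d id_blinfun"
    by (intro blinfun_eqI) (simp add: op_scaleC_apply)
  with d show thesis using that by blast
qed

lemma op_scaleC_id_inject:
  assumes inf: "infinite_dimensional TYPE('h::complex_hilbert)"
    and eq: "op_scaleC c (id_blinfun :: 'h op) = op_scaleC d id_blinfun"
  shows "c = d"
proof -
  obtain e :: 'h where e: "cinner e e = 1" using unit_vector_exists[OF inf] by blast
  have "c *\<^sub>C e = d *\<^sub>C e"
    using arg_cong[OF eq, of "\<lambda>T. blinfun_apply T e"] by (simp add: op_scaleC_apply)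
  then have "cinner (c *\<^sub>C e) e = cinner (d *\<^sub>C e) e" by (simp only:)
  then show ?thesis by (simp add: cinner_scaleC_left e)
qed

lemma sum_monomial_sq: "(\<Sum>\<alpha> | length \<alpha> = k. (cmod (monomial \<zeta> \<alpha>))\<^sup>2) = ((norm \<zeta>)\<^sup>2) ^ k"
proof (induction k)
  case (Suc k)
  have "(\<Sum>\<alpha> | length \<alpha> = Suc k. (cmod (monomial \<zeta> \<alpha>))\<^sup>2)
      = (\<Sum>i\<in>UNIV. (cmod (\<zeta> $ i))\<^sup>2 * (\<Sum>\<alpha> | length \<alpha> = k. (cmod (monomial \<zeta> \<alpha>))\<^sup>2))"
    by (simp add: sum_words_eq_Suc norm_mult power_mult_distrib sum_distrib_left)
  then show ?case
    by (simp add: Suc.IH norm_cvec_sq flip: sum_distrib_right)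
qed simp

lemma nsq_monomial: "nsq N (monomial \<zeta>) = (\<Sum>k<N. ((norm \<zeta>)\<^sup>2) ^ k)"
  by (simp add: nsq_def sum_words_by_length sum_monomial_sq)

lemma nsq_monomial_tendsto:
  assumes "norm \<zeta> < 1"
  shows "(\<lambda>N. nsq N (monomial \<zeta>)) \<longlonglongrightarrow> 1 / (1 - (norm \<zeta>)\<^sup>2)"
  using geometric_sums[of "(norm \<zeta>)\<^sup>2"] assms
  by (simp add: nsq_monomial sums_def abs_square_less_1)

lemma nsq_monomial_le:
  assumes "norm \<zeta> < 1"
  shows "nsq N (monomial \<zeta>) \<le> 1 / (1 - (norm \<zeta>)\<^sup>2)"
  using nsq_monomial_tendsto[OF assms] by (rule incseq_le[rotated]) (simp add: incseq_def nsq_mono)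

lemma nsq_cnj: "nsq N (\<lambda>\<alpha>. cnj (g \<alpha>)) = nsq N g"
  by (simp add: nsq_def)

text \<open>Cauchy-Schwarz between g and the monomials, whose squares sum to 1 / (1 - |\<zeta>|^2),
  the diagonal value of the Szego kernel.\<close>

lemma scalar_evaluation_bound:
  assumes inf: "infinite_dimensional TYPE('h::complex_hilbert)"
    and \<zeta>: "norm \<zeta> < 1" and g: "\<And>N. nsq N g \<le> B"
    and s: "(\<lambda>k. homogeneous_part g k (scalar_point \<zeta> :: 'h op ^ 'n::finite)) sums op_scaleC d id_blinfun"
  shows "(cmod d)\<^sup>2 * (1 - (norm \<zeta>)\<^sup>2) \<le> B"
proof -
  have z: "0 < 1 - (norm \<zeta>)\<^sup>2" using \<zeta> by (simp add: abs_square_less_1)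
  have B: "0 \<le> B" using g[of 0] by simp
  obtain d' where d': "(\<lambda>k. \<Sum>\<alpha> | length \<alpha> = k. g \<alpha> * monomial \<zeta> \<alpha>) sums d'"
    and "op_scaleC d (id_blinfun :: 'h op) = op_scaleC d' id_blinfun"
    using scalar_sums[OF inf s[unfolded homogeneous_part_scalar_point]] .
  then have "d = d'" using op_scaleC_id_inject[OF inf] by blast
  with d' have d: "(\<lambda>N. \<Sum>\<alpha>\<in>words N. g \<alpha> * monomial \<zeta> \<alpha>) \<longlonglongrightarrow> d"
    by (simp add: sums_def sum_words_by_length)
  have "cmod d \<le> sqrt B * sqrt (1 / (1 - (norm \<zeta>)\<^sup>2))"
  proof (rule LIMSEQ_le_const2[OF tendsto_norm[OF d]], intro exI allI impI)
    fix N
    have "cmod (\<Sum>\<alpha>\<in>words N. g \<alpha> * monomial \<zeta> \<alpha>) \<le> (\<Sum>\<alpha>\<in>words N. cmod (g \<alpha>) * cmod (monomial \<zeta> \<alpha>))"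
      by (rule order.trans[OF norm_sum]) (simp add: norm_mult)
    also have "\<dots> \<le> sqrt (nsq N g) * sqrt (nsq N (monomial \<zeta>))"
      unfolding nsq_def by (rule sum_norm_mult_le)
    also have "\<dots> \<le> sqrt B * sqrt (1 / (1 - (norm \<zeta>)\<^sup>2))"
      using B by (intro mult_mono real_sqrt_le_mono g nsq_monomial_le[OF \<zeta>]) simp_all
    finally show "cmod (\<Sum>\<alpha>\<in>words N. g \<alpha> * monomial \<zeta> \<alpha>) \<le> sqrt B * sqrt (1 / (1 - (norm \<zeta>)\<^sup>2))" .
  qed
  then have "(cmod d)\<^sup>2 \<le> (sqrt B * sqrt (1 / (1 - (norm \<zeta>)\<^sup>2)))\<^sup>2"
    by (intro power_mono) auto
  also have "\<dots> = B / (1 - (norm \<zeta>)\<^sup>2)"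
    unfolding power_mult_distrib using B z by simp
  finally show ?thesis using z by (simp add: pos_le_divide_eq)
qed

text \<open>Monomials are multiplicative under concatenation, so f \<ell> takes the value f(\<mu>)
  \<ell>(\<mu>); the shift from d to \<open>Suc d\<close> keeps this exact for truncated
  sums.\<close>

lemma sum_mult_linear_form_monomial:
  "(\<Sum>\<gamma>\<in>words (Suc d). mult_linear_form z f \<gamma> * monomial \<mu> \<gamma>)
    = (\<Sum>i\<in>UNIV. \<mu> $ i * cnj (z i)) * (\<Sum>\<alpha>\<in>words d. f \<alpha> * monomial \<mu> (\<alpha> :: 'n::finite list))"
proof -
  have "(\<Sum>i\<in>UNIV. \<mu> $ i * cnj (z i)) * (\<Sum>\<alpha>\<in>words d. f \<alpha> * monomial \<mu> \<alpha>)
      = (\<Sum>(i, \<alpha>)\<in>UNIV \<times> words d. \<mu> $ i * cnj (z i) * (f \<alpha> * monomial \<mu> \<alpha>))"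
    by (simp add: sum_product sum.cartesian_product)
  also have "\<dots> = (\<Sum>\<gamma>\<in>words (Suc d) - {[]}. mult_linear_form z f \<gamma> * monomial \<mu> \<gamma>)"
    by (rule sum.reindex_bij_witness[where j = "\<lambda>(i, \<alpha>). \<alpha> @ [i]" and i = "\<lambda>\<gamma>. (last \<gamma>, butlast \<gamma>)"])
      (auto simp: mult_linear_form_def monomial_append less_diff_conv2 Suc_le_eq)
  also have "\<dots> = (\<Sum>\<gamma>\<in>words (Suc d). mult_linear_form z f \<gamma> * monomial \<mu> \<gamma>)"
    by (subst (2) sum.remove[of _ "[]"]) simp_all
  finally show ?thesis ..
qed

lemma zero_in_nc_ball: "0 \<in> (nc_ball :: ('h::complex_hilbert op ^ 'n::finite) set)"
  unfolding nc_ball_iff by (auto simp: bounded_ops_def intro!: exI[of _ 0])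

section \<open>Self maps of the ball and their composition operators\<close>

definition self_coeff ::
    "('h::complex_hilbert op ^ 'n::finite \<Rightarrow> 'h op ^ 'n) \<Rightarrow> 'n \<Rightarrow> 'n list \<Rightarrow> complex" where
  "self_coeff \<phi> i = free_coeff (\<lambda>X. \<phi> X $ i)"

context
  fixes \<phi> :: "'h::complex_hilbert op ^ 'n::finite \<Rightarrow> 'h op ^ 'n"
  assumes inf: "infinite_dimensional TYPE('h)" and self: "free_holomorphic_self_map \<phi>"
begin

lemma self_coeff_series: "has_free_series (\<lambda>X. \<phi> X $ i) (self_coeff \<phi> i)"
  using self free_coeff_eq[OF inf]
  unfolding free_holomorphic_self_map_def free_holomorphic_def self_coeff_def by force

lemma self_map_in: "X \<in> nc_ball \<Longrightarrow> \<phi> X \<in> nc_ball"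
  using self by (auto simp: free_holomorphic_self_map_def)

lemma self_coeff_sums: "X \<in> nc_ball \<Longrightarrow> (\<lambda>k. homogeneous_part (self_coeff \<phi> i) k X) sums (\<phi> X $ i)"
  using free_series_sums[OF self_coeff_series] by simp

lemma self_map_scalar_point:
  assumes "norm \<zeta> < 1"
  obtains \<mu> where "\<phi> (scalar_point \<zeta>) = scalar_point \<mu>" and "norm \<mu> < 1"
proof -
  have b: "(scalar_point \<zeta> :: 'h op ^ 'n) \<in> nc_ball"
    using assms scalar_point_in_nc_ball_iff[OF inf] by blast
  have "\<exists>d. \<phi> (scalar_point \<zeta>) $ i = op_scaleC d id_blinfun" for i
    using scalar_sums[OF inf self_coeff_sums[OF b, of i, unfolded homogeneous_part_scalar_point]] by metis
  then obtain d where "\<And>i. \<phi> (scalar_point \<zeta>) $ i = op_scaleC (d i) id_blinfun" by metis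
  then have eq: "\<phi> (scalar_point \<zeta>) = scalar_point (\<chi> i. d i)"
    by (simp add: vec_eq_iff scalar_point_def)
  moreover have "norm (\<chi> i. d i) < 1"
    using self_map_in[OF b] scalar_point_in_nc_ball_iff[OF inf] unfolding eq by blast
  ultimately show thesis using that by blast
qed

text \<open>At 0 every word except [] vanishes, which leaves the constant coefficients. The norm of
  \<open>value_at_zero\<close> is therefore the r of \<open>row_contraction\<close>.\<close>

lemma value_at_zero_self_map: "value_at_zero \<phi> = (\<chi> i. self_coeff \<phi> i [])"
    and self_map_zero: "\<phi> 0 = scalar_point (value_at_zero \<phi>)"
proof -
  have z: "\<phi> 0 $ i = op_scaleC (self_coeff \<phi> i []) id_blinfun" for i
  proof -
    have "homogeneous_part (self_coeff \<phi> i) k (0 :: 'h op ^ 'n) = 0" if "k \<noteq> 0" for k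
    proof (rule blinfun_eqI)
      have "word_op (0 :: 'h op ^ 'n) \<alpha> = 0" if "length \<alpha> = k" for \<alpha>
        using that \<open>k \<noteq> 0\<close> by (cases \<alpha>) (auto intro!: blinfun_eqI)
      then show "blinfun_apply (homogeneous_part (self_coeff \<phi> i) k 0) x = blinfun_apply (0 :: 'h op) x" for x
        by (simp add: homogeneous_part_apply)
    qed
    then have "(\<lambda>k. homogeneous_part (self_coeff \<phi> i) k (0 :: 'h op ^ 'n))
        sums (\<Sum>k\<in>{0}. homogeneous_part (self_coeff \<phi> i) k 0)"
      by (intro sums_finite) auto
    then show ?thesis
      using sums_unique2[OF self_coeff_sums[OF zero_in_nc_ball]] by (simp add: homogeneous_part_0)
  qed
  show "value_at_zero \<phi> = (\<chi> i. self_coeff \<phi> i [])"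
    unfolding value_at_zero_def
  proof (rule the_equality)
    show "w = (\<chi> i. self_coeff \<phi> i [])" if "\<forall>i. \<phi> 0 $ i = op_scaleC (w $ i) id_blinfun" for w
      using that op_scaleC_id_inject[OF inf] unfolding z by (simp add: vec_eq_iff)
  qed (simp add: z)
  then show "\<phi> 0 = scalar_point (value_at_zero \<phi>)"
    by (simp add: vec_eq_iff z scalar_point_def)
qed

lemma norm_value_at_zero_less: "norm (value_at_zero \<phi>) < 1"
  using self_map_in[OF zero_in_nc_ball] scalar_point_in_nc_ball_iff[OF inf] unfolding self_map_zero by blast

lemma row_contraction_self_coeff: "row_contraction (self_coeff \<phi>) (norm (value_at_zero \<phi>))"
proof
  show "row_contractive (self_coeff \<phi>)"
    using self_map_row_contractive[OF inf self_coeff_series] self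
    by (simp add: free_holomorphic_self_map_def)
  show "norm (value_at_zero \<phi>) = sqrt (\<Sum>i\<in>UNIV. (cmod (self_coeff \<phi> i []))\<^sup>2)"
    by (simp add: value_at_zero_self_map norm_vec_def L2_set_def)
qed (rule norm_value_at_zero_less)

interpretation row_contraction "self_coeff \<phi>" "norm (value_at_zero \<phi>)"
  by (rule row_contraction_self_coeff)

lemma comp_op_apply:
  assumes f: "f \<in> H2_ball" and X: "X \<in> nc_ball"
  shows "comp_op \<phi> f X = f (\<phi> X)"
  using free_series_sums[OF H2_ballD(1)[OF inf f] self_map_in[OF X]]
  by (simp add: comp_op_def sums_iff)

lemma comp_op_H2:
  assumes f: "f \<in> H2_ball"
  shows "comp_op \<phi> f \<in> H2_ball"
    and "(H2_norm (comp_op \<phi> f))\<^sup>2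
      \<le> (1 + norm (value_at_zero \<phi>)) / (1 - norm (value_at_zero \<phi>)) * (H2_norm f)\<^sup>2"
proof -
  obtain b where b: "\<And>N. nsq N b
      \<le> (1 + norm (value_at_zero \<phi>)) / (1 - norm (value_at_zero \<phi>)) * (H2_norm f)\<^sup>2"
    and s: "\<And>X Y. \<lbrakk>X \<in> nc_ball; Y \<in> nc_ball; \<And>i. (\<lambda>k. homogeneous_part (self_coeff \<phi> i) k X) sums (Y $ i)\<rbrakk>
      \<Longrightarrow> (\<lambda>k. homogeneous_part b k (X :: 'h op ^ 'n)) sums (\<Sum>k. homogeneous_part (free_coeff f) k Y)"
    using composition_series[OF H2_ballD(2,3)[OF inf f]] by metis
  have "(\<lambda>k. homogeneous_part b k X) sums comp_op \<phi> f X" if "X \<in> nc_ball" for X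
    unfolding comp_op_def by (rule s[OF that self_map_in[OF that] self_coeff_sums[OF that]])
  from H2_ballI(1,3)[OF inf b this] show "comp_op \<phi> f \<in> H2_ball"
    "(H2_norm (comp_op \<phi> f))\<^sup>2
      \<le> (1 + norm (value_at_zero \<phi>)) / (1 - norm (value_at_zero \<phi>)) * (H2_norm f)\<^sup>2"
    by blast+
qed

lemma H2_norm_comp_op_le:
  assumes "f \<in> H2_ball"
  shows "H2_norm (comp_op \<phi> f)
    \<le> sqrt ((1 + norm (value_at_zero \<phi>)) / (1 - norm (value_at_zero \<phi>))) * H2_norm f"
  using real_sqrt_le_mono[OF comp_op_H2(2)[OF assms], unfolded real_sqrt_mult]
  by (simp add: H2_norm_nonneg)

text \<open>Evaluate the defect inequality at a scalar point, for the truncations of the Szego kernel at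
  the image point.\<close>

lemma schwarz_pick:
  assumes \<zeta>: "norm \<zeta> < 1" and \<mu>: "\<phi> (scalar_point \<zeta>) = scalar_point \<mu>"
  shows "(1 - (norm \<zeta>)\<^sup>2) * (cmod (1 - (\<Sum>i\<in>UNIV. \<mu> $ i * cnj (value_at_zero \<phi> $ i))))\<^sup>2
    \<le> (1 - (norm (value_at_zero \<phi>))\<^sup>2) * (1 - (norm \<mu>)\<^sup>2)"
proof -
  let ?X = "scalar_point \<zeta> :: 'h op ^ 'n" and ?Y = "scalar_point \<mu> :: 'h op ^ 'n"
  have X: "?X \<in> nc_ball" using \<zeta> scalar_point_in_nc_ball_iff[OF inf] by blast
  have Y: "?Y \<in> nc_ball" using self_map_in[OF X] \<mu> by simp
  then have \<mu>1: "norm \<mu> < 1" using scalar_point_in_nc_ball_iff[OF inf] by blast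
  then have \<mu>2: "0 < 1 - (norm \<mu>)\<^sup>2" by (simp add: abs_square_less_1)
  define w where "w = (\<Sum>i\<in>UNIV. \<mu> $ i * cnj (self_coeff \<phi> i []))"
  define S where "S d = nsq d (monomial \<mu>)" for d
  have ineq: "(cmod (1 - w))\<^sup>2 * S d * (1 - (norm \<zeta>)\<^sup>2) \<le> 1 - (norm (value_at_zero \<phi>))\<^sup>2" if d: "d > 0" for d
  proof -
    \<comment> \<open>The Szego kernel at \<mu>, cut off at degree d because
      \<open>subst_defect\<close> is about polynomials. At \<mu> the product g (1 - \<ell>) has the
      value (1 - w) S d, while its composition with \<phi> has squared norm at most (1 - |z|^2) S d,
      where z = \<phi>(0).\<close>
    define g where "g \<alpha> = (if length \<alpha> < d then cnj (monomial \<mu> \<alpha>) else 0)" for \<alpha>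
    define D where "D \<alpha> = g \<alpha> - mult_zero_form g \<alpha>" for \<alpha>
    have gS: "nsq d g = S d"
      unfolding nsq_def S_def by (intro sum.cong) (simp_all add: g_def)
    have g_sum: "(\<Sum>\<alpha>\<in>words d. g \<alpha> * monomial \<mu> \<alpha>) = complex_of_real (S d)"
      unfolding S_def nsq_def of_real_sum complex_norm_square
      by (intro sum.cong) (simp_all add: g_def mult.commute)
    have g_sum': "(\<Sum>\<alpha>\<in>words (Suc d). g \<alpha> * monomial \<mu> \<alpha>) = complex_of_real (S d)"
      unfolding g_sum[symmetric] by (intro sum.mono_neutral_right) (auto simp: g_def)
    have "(\<Sum>k<Suc d. homogeneous_part D k ?Y)
        = op_scaleC (\<Sum>\<alpha>\<in>words (Suc d). D \<alpha> * monomial \<mu> \<alpha>) id_blinfun"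
      unfolding sum_words_by_length homogeneous_part_scalar_point
      by (rule blinfun_eqI) (simp add: op_scaleC_apply blinfun.sum_left cvec.scale_sum_left scaleC_add_left blinfun.add_left)
    also have "(\<Sum>\<alpha>\<in>words (Suc d). D \<alpha> * monomial \<mu> \<alpha>) = (1 - w) * complex_of_real (S d)"
      unfolding D_def left_diff_distrib sum_subtractf g_sum' sum_mult_linear_form_monomial g_sum w_def by simp
    finally have val: "(\<Sum>k<Suc d. homogeneous_part D k ?Y) = op_scaleC ((1 - w) * complex_of_real (S d)) id_blinfun" .
    have "(\<lambda>k. homogeneous_part (subst_series (self_coeff \<phi>) (Suc d) D) k ?X)
        sums op_scaleC ((1 - w) * complex_of_real (S d)) id_blinfun"
      unfolding val[symmetric] by (rule subst_series_sums[OF X Y]) (use self_coeff_sums[OF X] \<mu> in simp)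
    moreover have "nsq N (subst_series (self_coeff \<phi>) (Suc d) D) \<le> (1 - (norm (value_at_zero \<phi>))\<^sup>2) * S d" for N
      using subst_defect[of d g N] by (simp add: D_def[abs_def] gS) (simp add: g_def)
    ultimately have "(cmod ((1 - w) * complex_of_real (S d)))\<^sup>2 * (1 - (norm \<zeta>)\<^sup>2)
        \<le> (1 - (norm (value_at_zero \<phi>))\<^sup>2) * S d"
      by (intro scalar_evaluation_bound[OF inf \<zeta>])
    then have "((cmod (1 - w))\<^sup>2 * S d * (1 - (norm \<zeta>)\<^sup>2)) * S d \<le> (1 - (norm (value_at_zero \<phi>))\<^sup>2) * S d"
      by (simp add: norm_mult power_mult_distrib power2_eq_square mult_ac)
    moreover have "S d > 0"
      using d nsq_mono[of 1 d "monomial \<mu>"] by (simp add: S_def nsq_Suc)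
    ultimately show ?thesis by (simp only: mult_le_cancel_right)
  qed
  have "(cmod (1 - w))\<^sup>2 * (1 / (1 - (norm \<mu>)\<^sup>2)) * (1 - (norm \<zeta>)\<^sup>2) \<le> 1 - (norm (value_at_zero \<phi>))\<^sup>2"
  proof (rule LIMSEQ_le_const2)
    show "(\<lambda>d. (cmod (1 - w))\<^sup>2 * S d * (1 - (norm \<zeta>)\<^sup>2))
        \<longlonglongrightarrow> (cmod (1 - w))\<^sup>2 * (1 / (1 - (norm \<mu>)\<^sup>2)) * (1 - (norm \<zeta>)\<^sup>2)"
      unfolding S_def by (intro tendsto_intros nsq_monomial_tendsto \<mu>1)
  qed (use ineq in \<open>auto intro!: exI[of _ 1]\<close>)
  then have "(1 - (norm \<zeta>)\<^sup>2) * (cmod (1 - w))\<^sup>2 \<le> (1 - (norm (value_at_zero \<phi>))\<^sup>2) * (1 - (norm \<mu>)\<^sup>2)"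
    using \<mu>2 by (simp add: field_simps)
  then show ?thesis
    unfolding w_def value_at_zero_self_map by simp
qed

end

section \<open>Szego kernels\<close>

definition szego_kernel :: "complex ^ 'n \<Rightarrow> 'h::complex_hilbert op ^ 'n::finite \<Rightarrow> 'h op" where
  "szego_kernel \<mu> X = (\<Sum>k. homogeneous_part (\<lambda>\<alpha>. cnj (monomial \<mu> \<alpha>)) k X)"

text \<open>Norm and value at \<mu> come from the same geometric series in |\<mu>|^2, as befits a
  reproducing kernel. This coincidence is what \<open>kernel_ratio\<close> exploits.\<close>

lemma szego_kernel:
  fixes \<mu> :: "complex ^ 'n::finite"
  assumes inf: "infinite_dimensional TYPE('h::complex_hilbert)" and \<mu>: "norm \<mu> < 1"
  shows "(szego_kernel \<mu> :: 'h op ^ 'n \<Rightarrow> 'h op) \<in> H2_ball"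
    and "(H2_norm (szego_kernel \<mu> :: 'h op ^ 'n \<Rightarrow> 'h op))\<^sup>2 = 1 / (1 - (norm \<mu>)\<^sup>2)"
    and "(szego_kernel \<mu> (scalar_point \<mu>) :: 'h op) = op_scaleC (complex_of_real (1 / (1 - (norm \<mu>)\<^sup>2))) id_blinfun"
proof -
  have b: "nsq N (\<lambda>\<alpha>. cnj (monomial \<mu> \<alpha>)) \<le> 1 / (1 - (norm \<mu>)\<^sup>2)" for N
    unfolding nsq_cnj by (rule nsq_monomial_le[OF \<mu>])
  have s: "(\<lambda>k. homogeneous_part (\<lambda>\<alpha>. cnj (monomial \<mu> \<alpha>)) k X) sums szego_kernel \<mu> X"
    if "X \<in> nc_ball" for X :: "'h op ^ 'n"
    unfolding szego_kernel_def by (rule summable_sums[OF summable_homogeneous_part[OF that b]])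
  note H = H2_ballI[OF inf b s]
  show k: "(szego_kernel \<mu> :: 'h op ^ 'n \<Rightarrow> 'h op) \<in> H2_ball" by (rule H(1))
  have coeff: "free_coeff (szego_kernel \<mu> :: 'h op ^ 'n \<Rightarrow> 'h op) = (\<lambda>\<alpha>. cnj (monomial \<mu> \<alpha>))" by (rule H(2))
  show "(H2_norm (szego_kernel \<mu> :: 'h op ^ 'n \<Rightarrow> 'h op))\<^sup>2 = 1 / (1 - (norm \<mu>)\<^sup>2)"
    using H2_ballD(3)[OF inf k] nsq_monomial_tendsto[OF \<mu>]
    unfolding coeff nsq_cnj by (rule LIMSEQ_unique)
  have "(scalar_point \<mu> :: 'h op ^ 'n) \<in> nc_ball"
    using \<mu> scalar_point_in_nc_ball_iff[OF inf] by blast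
  note s\<mu> = s[OF this, unfolded homogeneous_part_scalar_point]
  obtain d where d: "(\<lambda>k. \<Sum>\<alpha> | length \<alpha> = k. cnj (monomial \<mu> \<alpha>) * monomial \<mu> \<alpha>) sums d"
    and eq: "(szego_kernel \<mu> (scalar_point \<mu>) :: 'h op) = op_scaleC d id_blinfun"
    by (rule scalar_sums[OF inf s\<mu>])
  have "(\<Sum>\<alpha> | length \<alpha> = k. cnj (monomial \<mu> \<alpha>) * monomial \<mu> \<alpha>) = complex_of_real (((norm \<mu>)\<^sup>2) ^ k)" for k
    unfolding sum_monomial_sq[symmetric] of_real_sum complex_norm_square by (simp add: mult.commute)
  then have "(\<lambda>k. complex_of_real (((norm \<mu>)\<^sup>2) ^ k)) sums d" using d by simp
  moreover have "(\<lambda>k. complex_of_real (((norm \<mu>)\<^sup>2) ^ k)) sums complex_of_real (1 / (1 - (norm \<mu>)\<^sup>2))"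
    using \<mu> by (intro sums_of_real geometric_sums) (simp add: abs_square_less_1)
  ultimately show "(szego_kernel \<mu> (scalar_point \<mu>) :: 'h op) = op_scaleC (complex_of_real (1 / (1 - (norm \<mu>)\<^sup>2))) id_blinfun"
    unfolding eq using sums_unique2 by blast
qed

text \<open>Symmetric in \<phi> and \<psi>, so that every result can be reused with the two
  exchanged.\<close>

locale inverse_self_maps =
  fixes \<phi> \<psi> :: "'h::complex_hilbert op ^ 'n::finite \<Rightarrow> 'h op ^ 'n"
  assumes inf: "infinite_dimensional TYPE('h)"
    and self_phi: "free_holomorphic_self_map \<phi>" and self_psi: "free_holomorphic_self_map \<psi>"
    and phi_psi: "X \<in> nc_ball \<Longrightarrow> \<phi> (\<psi> X) = X" and psi_phi: "X \<in> nc_ball \<Longrightarrow> \<psi> (\<phi> X) = X"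
begin

text \<open>Schwarz-Pick for \<phi> at \<zeta> = \<psi>(0), whose image is \<mu> = 0, reads 1 -
  |\<psi>(0)|^2 \<le> 1 - |\<phi>(0)|^2.\<close>

lemma norm_value_le: "norm (value_at_zero \<phi>) \<le> norm (value_at_zero \<psi>)"
proof -
  let ?q = "value_at_zero \<psi>"
  have q: "norm ?q < 1" by (rule norm_value_at_zero_less[OF inf self_psi])
  have "\<phi> (scalar_point ?q) = scalar_point 0"
    using phi_psi[OF zero_in_nc_ball] unfolding self_map_zero[OF inf self_psi] scalar_point_0 .
  from schwarz_pick[OF inf self_phi q this]
  have "(norm (value_at_zero \<phi>))\<^sup>2 \<le> (norm ?q)\<^sup>2" by simp
  then show ?thesis by (rule power2_le_imp_le) simp
qed

end

lemma inverse_self_maps_sym: "inverse_self_maps \<phi> \<psi> \<Longrightarrow> inverse_self_maps \<psi> \<phi>"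
  by (simp add: inverse_self_maps_def)

context inverse_self_maps
begin

abbreviation "r \<equiv> norm (value_at_zero \<phi>)"

lemma norm_value_psi: "norm (value_at_zero \<psi>) = r"
  using norm_value_le inverse_self_maps.norm_value_le[OF inverse_self_maps_sym[OF inverse_self_maps_axioms]]
  by (rule antisym[rotated])

lemma r_less: "r < 1"
  by (rule norm_value_at_zero_less[OF inf self_phi])

text \<open>Test c on the kernel k at \<mu> = \<phi>(\<zeta>). The value of k \<circ> \<phi> at
  \<zeta> is k(\<mu>), the squared norm of k, so the evaluation bound gives 1 - |\<zeta>|^2 \<le>
  c^2 (1 - |\<mu>|^2). Schwarz-Pick for \<psi> at \<mu> has 1 - |\<zeta>|^2 on its right side, and
  combining the two cancels the unknown 1 - |\<mu>|^2.\<close>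

lemma kernel_ratio:
  assumes c: "\<And>f. f \<in> H2_ball \<Longrightarrow> H2_norm (comp_op \<phi> f) \<le> c * H2_norm f" and \<zeta>: "norm \<zeta> < 1"
  shows "(cmod (1 - (\<Sum>i\<in>UNIV. \<zeta> $ i * cnj (value_at_zero \<psi> $ i))))\<^sup>2 \<le> c\<^sup>2 * (1 - r\<^sup>2)"
proof -
  let ?X = "scalar_point \<zeta> :: 'h op ^ 'n"
  have X: "?X \<in> nc_ball" using \<zeta> scalar_point_in_nc_ball_iff[OF inf] by blast
  obtain \<mu> where \<mu>: "\<phi> ?X = scalar_point \<mu>" "norm \<mu> < 1"
    using self_map_scalar_point[OF inf self_phi \<zeta>] .
  define \<kappa> where "\<kappa> = 1 / (1 - (norm \<mu>)\<^sup>2)"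
  have m: "0 < 1 - (norm \<mu>)\<^sup>2" using \<mu> by (simp add: abs_square_less_1)
  then have \<kappa>: "\<kappa> > 0" by (simp add: \<kappa>_def)
  let ?k = "szego_kernel \<mu> :: 'h op ^ 'n \<Rightarrow> 'h op"
  note k = szego_kernel[OF inf \<mu>(2), folded \<kappa>_def]
  note F = comp_op_H2(1)[OF inf self_phi k(1)]
  have "comp_op \<phi> ?k ?X = op_scaleC (complex_of_real \<kappa>) id_blinfun"
    using comp_op_apply[OF inf self_phi k(1) X] k(3) by (simp add: \<mu>)
  then have "(\<lambda>j. homogeneous_part (free_coeff (comp_op \<phi> ?k)) j ?X) sums op_scaleC (complex_of_real \<kappa>) id_blinfun"
    using free_series_sums[OF H2_ballD(1)[OF inf F] X] by simp
  then have "(cmod (complex_of_real \<kappa>))\<^sup>2 * (1 - (norm \<zeta>)\<^sup>2) \<le> (H2_norm (comp_op \<phi> ?k))\<^sup>2"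
    by (rule scalar_evaluation_bound[OF inf \<zeta> H2_ballD(2)[OF inf F]])
  also have "\<dots> \<le> (c * H2_norm ?k)\<^sup>2"
    by (intro power_mono c k(1) H2_norm_nonneg)
  also have "\<dots> = c\<^sup>2 * \<kappa>" by (simp add: power_mult_distrib k(2))
  finally have "\<kappa> * (1 - (norm \<zeta>)\<^sup>2) * \<kappa> \<le> c\<^sup>2 * \<kappa>"
    by (simp add: power2_eq_square mult_ac)
  then have "\<kappa> * (1 - (norm \<zeta>)\<^sup>2) \<le> c\<^sup>2" using \<kappa> by (simp only: mult_le_cancel_right)
  then have 1: "1 - (norm \<zeta>)\<^sup>2 \<le> c\<^sup>2 * (1 - (norm \<mu>)\<^sup>2)"
    using m by (simp add: \<kappa>_def field_simps)
  have "\<psi> (scalar_point \<mu>) = scalar_point \<zeta>" using psi_phi[OF X] \<mu> by simp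
  from schwarz_pick[OF inf self_psi \<mu>(2) this]
  have "(1 - (norm \<mu>)\<^sup>2) * (cmod (1 - (\<Sum>i\<in>UNIV. \<zeta> $ i * cnj (value_at_zero \<psi> $ i))))\<^sup>2
      \<le> (1 - r\<^sup>2) * (1 - (norm \<zeta>)\<^sup>2)"
    unfolding norm_value_psi .
  also have "\<dots> \<le> (1 - r\<^sup>2) * (c\<^sup>2 * (1 - (norm \<mu>)\<^sup>2))"
    using r_less by (intro mult_left_mono 1) (simp add: abs_square_le_1)
  finally have "(1 - (norm \<mu>)\<^sup>2) * (cmod (1 - (\<Sum>i\<in>UNIV. \<zeta> $ i * cnj (value_at_zero \<psi> $ i))))\<^sup>2
      \<le> (1 - (norm \<mu>)\<^sup>2) * (c\<^sup>2 * (1 - r\<^sup>2))"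
    by (simp add: mult_ac)
  then show ?thesis using m by (simp only: mult_le_cancel_left)
qed

lemma upper_constant_sharp:
  assumes c: "\<And>f. f \<in> H2_ball \<Longrightarrow> H2_norm (comp_op \<phi> f) \<le> c * H2_norm f"
  shows "sqrt ((1 + r) / (1 - r)) \<le> c"
proof -
  let ?q = "value_at_zero \<psi>"
  have ineq: "(1 + t * r)\<^sup>2 \<le> c\<^sup>2 * (1 - r\<^sup>2)" if t: "0 < t" "t < 1" for t
  proof -
    \<comment> \<open>For r > 0 this is the point of norm t opposite to \<psi>(0), which makes the
      left side of \<open>kernel_ratio\<close> equal to (1 + t r)^2. For r = 0 the quotient t / r is
      0, so \<zeta> = 0, and the formula still holds.\<close>
    define \<zeta> where "\<zeta> = (- (t / r)) *\<^sub>R ?q"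
    have comp: "\<zeta> $ i = complex_of_real (- (t / r)) * ?q $ i" for i
      unfolding \<zeta>_def vector_scaleR_component by (simp add: scaleR_conv_of_real)
    have "norm \<zeta> \<le> t" using t by (simp add: \<zeta>_def norm_value_psi)
    then have \<zeta>: "norm \<zeta> < 1" using t by simp
    have "(\<Sum>i\<in>UNIV. \<zeta> $ i * cnj (?q $ i)) = complex_of_real (- (t / r) * (norm ?q)\<^sup>2)"
      unfolding norm_cvec_sq of_real_mult of_real_sum complex_norm_square
      by (simp only: comp sum_distrib_left mult.assoc)
    also have "- (t / r) * (norm ?q)\<^sup>2 = - (t * r)"
      by (cases "r = 0") (simp_all add: norm_value_psi power2_eq_square)
    finally have "1 - (\<Sum>i\<in>UNIV. \<zeta> $ i * cnj (?q $ i)) = complex_of_real (1 + t * r)"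
      by simp
    with kernel_ratio[OF c \<zeta>] have "(cmod (complex_of_real (1 + t * r)))\<^sup>2 \<le> c\<^sup>2 * (1 - r\<^sup>2)" by (simp only:)
    then show ?thesis by (simp only: norm_of_real power2_abs)
  qed
  have "(1 + 1 * r)\<^sup>2 \<le> c\<^sup>2 * (1 - r\<^sup>2)"
  proof (rule tendsto_upperbound)
    show "((\<lambda>t. (1 + t * r)\<^sup>2) \<longlongrightarrow> (1 + 1 * r)\<^sup>2) (at_left 1)"
      by (intro tendsto_intros)
    show "\<forall>\<^sub>F t in at_left 1. (1 + t * r)\<^sup>2 \<le> c\<^sup>2 * (1 - r\<^sup>2)"
      unfolding eventually_at_left_field using ineq by (intro exI[of _ 0]) auto
  qed simp
  then have "(1 + r) * (1 + r) \<le> (1 + r) * (c\<^sup>2 * (1 - r))"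
    by (simp add: power2_eq_square algebra_simps)
  moreover have "1 + r > 0" by (rule add_pos_nonneg) simp_all
  ultimately have "1 + r \<le> c\<^sup>2 * (1 - r)" by (simp only: mult_le_cancel_left)
  then have "(1 + r) / (1 - r) \<le> c\<^sup>2" using r_less by (simp add: pos_divide_le_eq)
  \<comment> \<open>The bound on c^2 says nothing about the sign of c. The kernel at 0 has norm 1,
    so c is at least the norm of its image.\<close>
  moreover have "0 \<le> c"
  proof -
    let ?k = "szego_kernel 0 :: 'h op ^ 'n \<Rightarrow> 'h op"
    have k: "?k \<in> H2_ball" "(H2_norm ?k)\<^sup>2 = 1" using szego_kernel[OF inf, of 0] by simp_all
    have "H2_norm ?k = 1" using k(2) H2_norm_nonneg[of ?k] by (simp add: power2_eq_1_iff)
    then show ?thesis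
      using order.trans[OF H2_norm_nonneg c[OF k(1)]] by simp
  qed
  ultimately show ?thesis by (intro real_le_lsqrt) simp_all
qed

text \<open>The two functions are compared on the ball only, where \<phi> and \<psi> are inverse to
  each other; this determines the coefficients and hence the norm.\<close>

lemma comp_psi_phi:
  assumes f: "f \<in> H2_ball"
  shows "H2_norm (comp_op \<psi> (comp_op \<phi> f)) = H2_norm f"
proof -
  note F = comp_op_H2(1)[OF inf self_phi f]
  note a = H2_ballD[OF inf f]
  have "comp_op \<psi> (comp_op \<phi> f) X = f X" if X: "X \<in> nc_ball" for X
    using comp_op_apply[OF inf self_psi F X] comp_op_apply[OF inf self_phi f self_map_in[OF inf self_psi X]]
      phi_psi[OF X] by simp
  then have "free_coeff (comp_op \<psi> (comp_op \<phi> f)) = free_coeff f"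
    using free_series_sums[OF a(1)] by (intro H2_ballI(2)[OF inf a(2)]) simp
  then show ?thesis by (simp add: H2_norm_def)
qed

lemma H2_norm_comp_op_ge:
  assumes f: "f \<in> H2_ball"
  shows "sqrt ((1 - r) / (1 + r)) * H2_norm f \<le> H2_norm (comp_op \<phi> f)"
proof -
  have "H2_norm f \<le> sqrt ((1 + r) / (1 - r)) * H2_norm (comp_op \<phi> f)"
    using H2_norm_comp_op_le[OF inf self_psi comp_op_H2(1)[OF inf self_phi f]]
    unfolding norm_value_psi comp_psi_phi[OF f] .
  from mult_left_mono[OF this, of "sqrt ((1 - r) / (1 + r))"]
  have "sqrt ((1 - r) / (1 + r)) * H2_norm f
      \<le> (sqrt ((1 - r) / (1 + r)) * sqrt ((1 + r) / (1 - r))) * H2_norm (comp_op \<phi> f)"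
    using r_less by (simp add: mult.assoc)
  moreover have "sqrt ((1 - r) / (1 + r)) * sqrt ((1 + r) / (1 - r)) = 1"
    using r_less add_pos_nonneg[of 1 r] unfolding real_sqrt_mult[symmetric] by simp
  ultimately show ?thesis by simp
qed

text \<open>A positive lower constant c for \<phi> is an upper constant 1 / c for \<psi>, since
  \<open>comp_op \<psi>\<close> followed by \<open>comp_op \<phi>\<close> preserves the norm.
  Sharpness of the upper constant for \<psi> then applies, with the same r.\<close>

lemma lower_constant_sharp:
  assumes c: "\<And>f. f \<in> H2_ball \<Longrightarrow> c * H2_norm f \<le> H2_norm (comp_op \<phi> f)"
  shows "c \<le> sqrt ((1 - r) / (1 + r))"
proof (cases "c \<le> 0")
  case True
  then show ?thesis using r_less by (intro order.trans[OF True]) simp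
next
  case False
  interpret inv: inverse_self_maps \<psi> \<phi>
    by (rule inverse_self_maps_sym[OF inverse_self_maps_axioms])
  have "H2_norm (comp_op \<psi> f) \<le> (1 / c) * H2_norm f" if f: "f \<in> H2_ball" for f
    using c[OF comp_op_H2(1)[OF inf self_psi f]] False
    unfolding inv.comp_psi_phi[OF f] by (simp add: field_simps)
  from inv.upper_constant_sharp[OF this] have "sqrt ((1 + r) / (1 - r)) \<le> 1 / c"
    unfolding norm_value_psi .
  then have "c \<le> 1 / sqrt ((1 + r) / (1 - r))"
    using False r_less add_pos_nonneg[of 1 r] by (simp add: field_simps)
  then show ?thesis by (simp add: real_sqrt_divide)
qed

text \<open>The supremum is itself an admissible upper constant, by normalising f to norm 1, so
  \<open>upper_constant_sharp\<close> bounds it from below. If f has norm 0, the known upper bound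
  settles the case.\<close>

lemma H2_opnorm_comp_op: "H2_opnorm (comp_op \<phi>) = sqrt ((1 + r) / (1 - r))"
proof (rule antisym)
  let ?A = "{f \<in> H2_ball. H2_norm f \<le> 1} :: ('h op ^ 'n \<Rightarrow> 'h op) set"
  let ?C = "sqrt ((1 + r) / (1 - r))"
  have C: "0 \<le> ?C" using r_less by simp
  have le: "H2_norm (comp_op \<phi> f) \<le> ?C" if "f \<in> ?A" for f
    using H2_norm_comp_op_le[OF inf self_phi, of f] mult_left_mono[OF _ C, of "H2_norm f" 1] that by simp
  have bdd: "bdd_above ((\<lambda>f. H2_norm (comp_op \<phi> f)) ` ?A)"
    using le by (rule bdd_aboveI2)
  \<comment> \<open>The least upper bound rule for suprema requires a nonempty set.\<close>
  have "(\<lambda>_. 0) \<in> ?A"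
  proof -
    have "(\<lambda>k. homogeneous_part (\<lambda>_. 0) k X) sums 0" for X :: "'h op ^ 'n"
      using homogeneous_part_sum[of "\<lambda>_ _. 0" "{}" _ X] by simp
    from H2_ballI(1,3)[OF inf _ this, of 0] show ?thesis by simp
  qed
  then show "H2_opnorm (comp_op \<phi>) \<le> ?C"
    unfolding H2_opnorm_def using le by (intro cSUP_least) auto
  show "?C \<le> H2_opnorm (comp_op \<phi>)"
  proof (rule upper_constant_sharp)
    fix f :: "'h op ^ 'n \<Rightarrow> 'h op" assume f: "f \<in> H2_ball"
    show "H2_norm (comp_op \<phi> f) \<le> H2_opnorm (comp_op \<phi>) * H2_norm f"
    proof (cases "H2_norm f = 0")
      case True
      then show ?thesis using H2_norm_comp_op_le[OF inf self_phi f] by simp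
    next
      case False
      define s where "s = 1 / H2_norm f"
      have s: "s > 0" "s * H2_norm f = 1"
        using False H2_norm_nonneg[of f] by (simp_all add: s_def)
      define g where "g X = op_scaleC (complex_of_real s) (f X)" for X
      \<comment> \<open>The function h' is tied to the multiple of h on the ball only, because that
        is where \<open>comp_op \<phi> g\<close> is computed from
        \<open>comp_op \<phi> f\<close>.\<close>
      have scale: "(\<lambda>X. op_scaleC (complex_of_real s) (h X)) \<in> H2_ball"
        "H2_norm h' = s * H2_norm h"
        if h: "h \<in> H2_ball" and h': "\<And>X. X \<in> nc_ball \<Longrightarrow> h' X = op_scaleC (complex_of_real s) (h X)"
        for h h' :: "'h op ^ 'n \<Rightarrow> 'h op"
      proof -
        note a = H2_ballD[OF inf h]
        have b: "nsq N (\<lambda>\<alpha>. complex_of_real s * free_coeff h \<alpha>) \<le> s\<^sup>2 * (H2_norm h)\<^sup>2" for N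
          unfolding nsq_scale using mult_left_mono[OF a(2), of "s\<^sup>2"] by simp
        have sm: "(\<lambda>k. homogeneous_part (\<lambda>\<alpha>. complex_of_real s * free_coeff h \<alpha>) k X)
            sums op_scaleC (complex_of_real s) (h X)" if "X \<in> nc_ball" for X
          unfolding homogeneous_part_scale
          by (intro bounded_linear.sums[OF bounded_linear_op_scaleC] free_series_sums[OF a(1) that])
        show "(\<lambda>X. op_scaleC (complex_of_real s) (h X)) \<in> H2_ball"
          by (rule H2_ballI(1)[OF inf b sm])
        have fc: "free_coeff h' = (\<lambda>\<alpha>. complex_of_real s * free_coeff h \<alpha>)"
          by (rule H2_ballI(2)[OF inf b]) (use sm h' in simp)
        show "H2_norm h' = s * H2_norm h"
          unfolding H2_norm_def fc
          using s(1) by (simp add: norm_mult power_mult_distrib infsum_cmult_right' real_sqrt_mult)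
      qed
      have g: "g \<in> H2_ball" "H2_norm g = 1"
        using scale(1)[OF f, of g] scale(2)[OF f, of g] s by (simp_all add: g_def[abs_def])
      have "H2_norm (comp_op \<phi> g) = s * H2_norm (comp_op \<phi> f)"
        by (rule scale(2)[OF comp_op_H2(1)[OF inf self_phi f]])
          (simp add: comp_op_apply[OF inf self_phi] f g g_def)
      moreover have "H2_norm (comp_op \<phi> g) \<le> H2_opnorm (comp_op \<phi>)"
        unfolding H2_opnorm_def by (rule cSUP_upper[OF _ bdd]) (simp add: g)
      ultimately have "s * H2_norm (comp_op \<phi> f) * H2_norm f \<le> H2_opnorm (comp_op \<phi>) * H2_norm f"
        by (intro mult_right_mono H2_norm_nonneg) simp
      also have "s * H2_norm (comp_op \<phi> f) * H2_norm f = (s * H2_norm f) * H2_norm (comp_op \<phi> f)"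
        by (simp only: mult_ac)
      finally show ?thesis unfolding s(2) by simp
    qed
  qed
qed

end

theorem theorem2p1:
  fixes \<phi> :: "'h::complex_hilbert op ^ 'n::finite \<Rightarrow> 'h op ^ 'n"
  assumes "separable_space (euclidean :: 'h topology)"
    and "infinite_dimensional TYPE('h)"
    and "free_holomorphic_automorphism \<phi>"
  defines "r \<equiv> norm (value_at_zero \<phi>)"
  shows "(\<forall>f\<in>H2_ball. comp_op \<phi> f \<in> H2_ball)
    \<and> (\<forall>f\<in>H2_ball.
          sqrt ((1 - r) / (1 + r)) * H2_norm f \<le> H2_norm (comp_op \<phi> f) \<and>
          H2_norm (comp_op \<phi> f) \<le> sqrt ((1 + r) / (1 - r)) * H2_norm f)
    \<and> (\<forall>c. (\<forall>f\<in>H2_ball. c * H2_norm f \<le> H2_norm (comp_op \<phi> f)) \<longrightarrow>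
          c \<le> sqrt ((1 - r) / (1 + r)))
    \<and> (\<forall>c. (\<forall>f\<in>H2_ball. H2_norm (comp_op \<phi> f) \<le> c * H2_norm f) \<longrightarrow>
          sqrt ((1 + r) / (1 - r)) \<le> c)
    \<and> H2_opnorm (comp_op \<phi>) = sqrt ((1 + r) / (1 - r))"
proof -
  interpret inverse_self_maps \<phi> "inv_into nc_ball \<phi>"
    using assms(2,3) unfolding free_holomorphic_automorphism_def inverse_self_maps_def
    by (auto simp: bij_betw_inv_into_left bij_betw_inv_into_right)
  show ?thesis
    unfolding r_def
    using comp_op_H2(1)[OF inf self_phi] H2_norm_comp_op_ge H2_norm_comp_op_le[OF inf self_phi]
      lower_constant_sharp upper_constant_sharp H2_opnorm_comp_op
    by blast
qed

end
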